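(* Let $M$ be a real manifold of dimension $4k$ with complex structure $I$ and holomorphic symplectic structure $\sigma=\omega_J+i\omega_K$ (a nondegenerate closed $(2,0)$-form, with $\omega_J,\omega_K$ real). Then the generalized almost complex structure on $T\oplus T^*$ $$\mathcal J_t=(\sin t)\,\mathcal J_I+(\cos t)\,\mathcal J_{\omega_J}$$ is integrable for all $t\in[0,\tfrac{\pi}{2}]$. Therefore it is a family of generalized complex structures interpolating between a symplectic structure and a complex structure.
   Context: Let $T=TM$, and equip $T\oplus T^*$ with the inner product $\langle X+\xi,Y+\eta\rangle=\tfrac12(\xi(Y)+\eta(X))$ and the (untwisted) Courant bracket $[X+\xi,Y+\eta]=[X,Y]+\mathcal L_X\eta-i_Yd\xi$. A generalized almost complex structure on $T\oplus T^*$ is an orthogonal endomorphism $\mathcal J$ with $\mathcal J^2=-1$; it is integrable (and called a generalized complex structure) when its $+i$-eigenbundle in $(T\oplus T^* )\otimes\mathbb C$ is involutive for the Courant bracket. With respect to the decomposition $T\oplus T^*$, $$\mathcal J_I=\begin{pmatrix}-I&0\\0&I^*\end{pmatrix},\qquad \mathcal J_{\omega_J}=\begin{pmatrix}0&-\omega_J^{-1}\\\omega_J&0\end{pmatrix},$$ where a 2-form $\omega$ is viewed as the map $T\to T^*$, $X\mapsto i_X\omega$. These two endomorphisms anticommute. The first is the generalized complex structure determined by the complex structure $I$, the second the one determined by the symplectic form $\omega_J$. *)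

theory Defs
  imports "HOL-Analysis.Analysis"
begin

section \<open>Smooth manifolds\<close>

primrec times_differentiable_on ::
    "nat \<Rightarrow> 'a::real_normed_vector set \<Rightarrow> ('a \<Rightarrow> 'b::real_normed_vector) \<Rightarrow> bool" where
  "times_differentiable_on 0 S f \<longleftrightarrow> continuous_on S f"
| "times_differentiable_on (Suc n) S f \<longleftrightarrow>
     (\<forall>x\<in>S. f differentiable (at x)) \<and>
     (\<forall>v. times_differentiable_on n S (\<lambda>x. frechet_derivative f (at x) v))"

text \<open>Only used for open \<open>S\<close>, where it is the usual notion of a \<open>C\<^sup>\<infinity>\<close> map.\<close>

definition smooth_on :: "'a::real_normed_vector set \<Rightarrow> ('a \<Rightarrow> 'b::real_normed_vector) \<Rightarrow> bool" where
  "smooth_on S f \<longleftrightarrow> (\<forall>n. times_differentiable_on n S f)"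

text \<open>A chart is a pair of its domain and its coordinate map; the values of the coordinate map
  off the domain are irrelevant. The manifold is the whole type \<open>'m\<close>.\<close>

type_synonym ('m, 'e) chart = "'m set \<times> ('m \<Rightarrow> 'e)"

definition chart_inv :: "('m, 'e) chart \<Rightarrow> 'e \<Rightarrow> 'm" where
  "chart_inv c = inv_into (fst c) (snd c)"

definition is_chart :: "('m::topological_space, 'e::euclidean_space) chart \<Rightarrow> bool" where
  "is_chart c \<longleftrightarrow> open (fst c) \<and> open (snd c ` fst c) \<and>
     homeomorphism (fst c) (snd c ` fst c) (snd c) (chart_inv c)"

definition transition :: "('m, 'e) chart \<Rightarrow> ('m, 'e) chart \<Rightarrow> 'e \<Rightarrow> 'e" where
  "transition c d = snd d \<circ> chart_inv c"

definition smooth_atlas ::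
    "('m::{t2_space, second_countable_topology}, 'e::euclidean_space) chart set \<Rightarrow> bool" where
  "smooth_atlas A \<longleftrightarrow>
     (\<forall>c\<in>A. is_chart c) \<and> (\<Union>c\<in>A. fst c) = UNIV \<and>
     (\<forall>c\<in>A. \<forall>d\<in>A. smooth_on (snd c ` (fst c \<inter> fst d)) (transition c d))"


section \<open>Tangent and generalized tangent vectors\<close>

text \<open>
  A tangent vector at \<open>p\<close> is determined by its components in any one chart around \<open>p\<close>, the
  components in two charts being related by the derivative of the transition map. We fix a chart
  \<open>base_chart A p\<close> around every point and represent a tangent vector at \<open>p\<close> by its components in
  that chart, so that \<open>T\<^sub>pM\<close> is the model space \<open>'e\<close> and \<open>T\<^sub>p\<^sup>*M\<close> its dual. The base chart may jump
  from point to point; smoothness of a field therefore always refers to its components in a single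
  chart, which is what the functions \<open>*_rep\<close> below compute.
\<close>

definition base_chart :: "('m, 'e) chart set \<Rightarrow> 'm \<Rightarrow> ('m, 'e) chart" where
  "base_chart A p = (SOME c. c \<in> A \<and> p \<in> fst c)"

definition jacobian :: "('m, 'e::euclidean_space) chart \<Rightarrow> ('m, 'e) chart \<Rightarrow> 'm \<Rightarrow> 'e \<Rightarrow>\<^sub>L 'e" where
  "jacobian c d p = Blinfun (frechet_derivative (transition c d) (at (snd c p)))"

type_synonym 'e gtangent = "'e \<times> ('e \<Rightarrow>\<^sub>L real)"

definition gen_transfer ::
    "('m, 'e::euclidean_space) chart \<Rightarrow> ('m, 'e) chart \<Rightarrow> 'm \<Rightarrow> 'e gtangent \<Rightarrow> 'e gtangent" where
  "gen_transfer c d p w = (jacobian c d p (fst w), snd w o\<^sub>L jacobian d c p)"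

definition vec_rep ::
    "('m, 'e::euclidean_space) chart set \<Rightarrow> ('m, 'e) chart \<Rightarrow> ('m \<Rightarrow> 'e) \<Rightarrow> 'e \<Rightarrow> 'e" where
  "vec_rep A c X x = (let p = chart_inv c x in jacobian (base_chart A p) c p (X p))"

definition covec_rep ::
    "('m, 'e::euclidean_space) chart set \<Rightarrow> ('m, 'e) chart \<Rightarrow> ('m \<Rightarrow> 'e \<Rightarrow>\<^sub>L real) \<Rightarrow> 'e \<Rightarrow> 'e \<Rightarrow>\<^sub>L real" where
  "covec_rep A c \<xi> x = (let p = chart_inv c x in \<xi> p o\<^sub>L jacobian c (base_chart A p) p)"

definition endo_rep ::
    "('m, 'e::euclidean_space) chart set \<Rightarrow> ('m, 'e) chart \<Rightarrow> ('m \<Rightarrow> 'e \<Rightarrow>\<^sub>L 'e) \<Rightarrow> 'e \<Rightarrow> 'e \<Rightarrow> 'e" where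
  "endo_rep A c F x u =
     (let p = chart_inv c x; b = base_chart A p
      in jacobian b c p (F p (jacobian c b p u)))"

definition gen_endo_rep ::
    "('m, 'e::euclidean_space) chart set \<Rightarrow> ('m, 'e) chart \<Rightarrow>
     ('m \<Rightarrow> 'e gtangent \<Rightarrow> 'e gtangent) \<Rightarrow> 'e \<Rightarrow> 'e gtangent \<Rightarrow> 'e gtangent" where
  "gen_endo_rep A c J x w =
     (let p = chart_inv c x; b = base_chart A p
      in gen_transfer b c p (J p (gen_transfer c b p w)))"

text \<open>A 2-form \<open>\<omega>\<close> is stored, at each point, as the map \<open>X \<mapsto> i\<^sub>X \<omega>\<close>.\<close>

type_synonym ('m, 'e, 'b) form2 = "'m \<Rightarrow> 'e \<Rightarrow>\<^sub>L 'e \<Rightarrow>\<^sub>L 'b"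

definition form2_rep ::
    "('m, 'e::euclidean_space) chart set \<Rightarrow> ('m, 'e) chart \<Rightarrow>
     ('m, 'e, 'b::real_normed_vector) form2 \<Rightarrow> 'e \<Rightarrow> 'e \<Rightarrow> 'e \<Rightarrow> 'b" where
  "form2_rep A c \<omega> x u v =
     (let p = chart_inv c x; b = base_chart A p
      in \<omega> p (jacobian c b p u) (jacobian c b p v))"

definition smooth_vector_field_on ::
    "('m::topological_space, 'e::euclidean_space) chart set \<Rightarrow> 'm set \<Rightarrow> ('m \<Rightarrow> 'e) \<Rightarrow> bool" where
  "smooth_vector_field_on A U X \<longleftrightarrow>
     (\<forall>c\<in>A. smooth_on (snd c ` (fst c \<inter> U)) (vec_rep A c X))"

definition smooth_gen_section_on ::
    "('m::topological_space, 'e::euclidean_space) chart set \<Rightarrow> 'm set \<Rightarrow> ('m \<Rightarrow> 'e gtangent) \<Rightarrow> bool" where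
  "smooth_gen_section_on A U s \<longleftrightarrow>
     (\<forall>c\<in>A. smooth_on (snd c ` (fst c \<inter> U)) (vec_rep A c (\<lambda>p. fst (s p))) \<and>
             smooth_on (snd c ` (fst c \<inter> U)) (covec_rep A c (\<lambda>p. snd (s p))))"

definition smooth_endo ::
    "('m, 'e::euclidean_space) chart set \<Rightarrow> ('m \<Rightarrow> 'e \<Rightarrow>\<^sub>L 'e) \<Rightarrow> bool" where
  "smooth_endo A F \<longleftrightarrow> (\<forall>c\<in>A. \<forall>u. smooth_on (snd c ` fst c) (\<lambda>x. endo_rep A c F x u))"

definition smooth_gen_endo ::
    "('m, 'e::euclidean_space) chart set \<Rightarrow> ('m \<Rightarrow> 'e gtangent \<Rightarrow> 'e gtangent) \<Rightarrow> bool" where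
  "smooth_gen_endo A J \<longleftrightarrow>
     (\<forall>p. linear (J p)) \<and>
     (\<forall>c\<in>A. \<forall>w. smooth_on (snd c ` fst c) (\<lambda>x. gen_endo_rep A c J x w))"

definition smooth_form2 ::
    "('m, 'e::euclidean_space) chart set \<Rightarrow> ('m, 'e, 'b::real_normed_vector) form2 \<Rightarrow> bool" where
  "smooth_form2 A \<omega> \<longleftrightarrow>
     (\<forall>p v. \<omega> p v v = 0) \<and>
     (\<forall>c\<in>A. \<forall>u v. smooth_on (snd c ` fst c) (\<lambda>x. form2_rep A c \<omega> x u v))"


section \<open>Brackets and exterior derivatives\<close>

text \<open>
  The usual coordinate expressions, evaluated at \<open>p\<close> in the base chart of \<open>p\<close>. They are
  coordinate independent, so the choice of the chart is immaterial. No factor \<open>1/2\<close> enters the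
  exterior derivative: \<open>d\<xi>(X,Y) = X \<xi>(Y) - Y \<xi>(X) - \<xi>([X,Y])\<close>.
\<close>

definition lie_bracket ::
    "('m, 'e::euclidean_space) chart set \<Rightarrow> ('m \<Rightarrow> 'e) \<Rightarrow> ('m \<Rightarrow> 'e) \<Rightarrow> 'm \<Rightarrow> 'e" where
  "lie_bracket A X Y p =
     (let c = base_chart A p; x = snd c p
      in frechet_derivative (vec_rep A c Y) (at x) (X p)
         - frechet_derivative (vec_rep A c X) (at x) (Y p))"

definition lie_derivative1 ::
    "('m, 'e::euclidean_space) chart set \<Rightarrow> ('m \<Rightarrow> 'e) \<Rightarrow> ('m \<Rightarrow> 'e \<Rightarrow>\<^sub>L real) \<Rightarrow> 'm \<Rightarrow> 'e \<Rightarrow>\<^sub>L real" where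
  "lie_derivative1 A X \<eta> p =
     (let c = base_chart A p; x = snd c p
      in frechet_derivative (covec_rep A c \<eta>) (at x) (X p)
         + (\<eta> p o\<^sub>L Blinfun (frechet_derivative (vec_rep A c X) (at x))))"

definition ext_deriv1 ::
    "('m, 'e::euclidean_space) chart set \<Rightarrow> ('m \<Rightarrow> 'e \<Rightarrow>\<^sub>L real) \<Rightarrow> 'm \<Rightarrow> 'e \<Rightarrow> 'e \<Rightarrow> real" where
  "ext_deriv1 A \<xi> p u v =
     (let c = base_chart A p; D = frechet_derivative (covec_rep A c \<xi>) (at (snd c p))
      in D u v - D v u)"

definition ext_deriv2 ::
    "('m, 'e::euclidean_space) chart set \<Rightarrow> ('m, 'e, 'b::real_normed_vector) form2 \<Rightarrow>
     'm \<Rightarrow> 'e \<Rightarrow> 'e \<Rightarrow> 'e \<Rightarrow> 'b" where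
  "ext_deriv2 A \<omega> p u v w =
     (let c = base_chart A p;
          D = (\<lambda>y a b. frechet_derivative (\<lambda>x. form2_rep A c \<omega> x a b) (at (snd c p)) y)
      in D u v w + D v w u + D w u v)"

definition courant_bracket ::
    "('m, 'e::euclidean_space) chart set \<Rightarrow> ('m \<Rightarrow> 'e gtangent) \<Rightarrow> ('m \<Rightarrow> 'e gtangent) \<Rightarrow>
     'm \<Rightarrow> 'e gtangent" where
  "courant_bracket A s r p =
     (let X = (\<lambda>q. fst (s q)); \<xi> = (\<lambda>q. snd (s q)); Y = (\<lambda>q. fst (r q)); \<eta> = (\<lambda>q. snd (r q))
      in (lie_bracket A X Y p,
          lie_derivative1 A X \<eta> p - Blinfun (\<lambda>v. ext_deriv1 A \<xi> p (Y p) v)))"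


section \<open>Complexification and involutivity\<close>

text \<open>The pair \<open>(a, b)\<close> stands for \<open>a + i b\<close> in the complexification of a real vector space.\<close>

definition plus_i_eigenspace :: "('v::real_vector \<Rightarrow> 'v) \<Rightarrow> ('v \<times> 'v) set" where
  "plus_i_eigenspace F = {(a, b). (F a, F b) = (- b, a)}"

definition minus_i_eigenspace :: "('v::real_vector \<Rightarrow> 'v) \<Rightarrow> ('v \<times> 'v) set" where
  "minus_i_eigenspace F = {(a, b). (F a, F b) = (b, - a)}"

text \<open>
  \<open>L\<close> is a complex subbundle; the real bracket \<open>br\<close> is extended complex bilinearly. The bracket
  of smooth sections is again smooth, so being a section of \<open>L\<close> is the pointwise condition of
  lying in \<open>L\<close>.
\<close>

definition involutive ::
    "('m::topological_space set \<Rightarrow> ('m \<Rightarrow> 'v::real_vector) \<Rightarrow> bool) \<Rightarrow>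
     (('m \<Rightarrow> 'v) \<Rightarrow> ('m \<Rightarrow> 'v) \<Rightarrow> 'm \<Rightarrow> 'v) \<Rightarrow> ('m \<Rightarrow> ('v \<times> 'v) set) \<Rightarrow> bool" where
  "involutive smooth br L \<longleftrightarrow>
     (\<forall>U a b c d. open U \<and> smooth U a \<and> smooth U b \<and> smooth U c \<and> smooth U d \<and>
        (\<forall>p\<in>U. (a p, b p) \<in> L p) \<and> (\<forall>p\<in>U. (c p, d p) \<in> L p) \<longrightarrow>
        (\<forall>p\<in>U. (br a c p - br b d p, br a d p + br b c p) \<in> L p))"


section \<open>Complex, symplectic and holomorphic symplectic structures\<close>

definition complex_structure ::
    "('m::topological_space, 'e::euclidean_space) chart set \<Rightarrow> ('m \<Rightarrow> 'e \<Rightarrow>\<^sub>L 'e) \<Rightarrow> bool" where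
  "complex_structure A I \<longleftrightarrow>
     smooth_endo A I \<and> (\<forall>p v. I p (I p v) = - v) \<and>
     involutive (smooth_vector_field_on A) (lie_bracket A) (\<lambda>p. plus_i_eigenspace (I p))"

definition closed_form2 ::
    "('m, 'e::euclidean_space) chart set \<Rightarrow> ('m, 'e, 'b::real_normed_vector) form2 \<Rightarrow> bool" where
  "closed_form2 A \<omega> \<longleftrightarrow> (\<forall>p u v w. ext_deriv2 A \<omega> p u v w = 0)"

definition symplectic_form ::
    "('m, 'e::euclidean_space) chart set \<Rightarrow> ('m, 'e, real) form2 \<Rightarrow> bool" where
  "symplectic_form A \<omega> \<longleftrightarrow>
     smooth_form2 A \<omega> \<and> closed_form2 A \<omega> \<and> (\<forall>p v. \<omega> p v = 0 \<longrightarrow> v = 0)"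

definition complex_bilinear_ext ::
    "('e::real_normed_vector \<Rightarrow>\<^sub>L 'e \<Rightarrow>\<^sub>L complex) \<Rightarrow> 'e \<times> 'e \<Rightarrow> 'e \<times> 'e \<Rightarrow> complex" where
  "complex_bilinear_ext s z w =
     s (fst z) (fst w) - s (snd z) (snd w) + \<i> * (s (fst z) (snd w) + s (snd z) (fst w))"

text \<open>Type \<open>(2,0)\<close> means that the contraction with any vector of type \<open>(0,1)\<close> vanishes;
  nondegeneracy is that of the induced form on \<open>T\<^sup>1\<^sup>,\<^sup>0\<close>. A closed \<open>(2,0)\<close>-form is holomorphic.\<close>

definition holomorphic_symplectic ::
    "('m::topological_space, 'e::euclidean_space) chart set \<Rightarrow> ('m \<Rightarrow> 'e \<Rightarrow>\<^sub>L 'e) \<Rightarrow>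
     ('m, 'e, complex) form2 \<Rightarrow> bool" where
  "holomorphic_symplectic A I \<sigma> \<longleftrightarrow>
     smooth_form2 A \<sigma> \<and> closed_form2 A \<sigma> \<and>
     (\<forall>p. \<forall>z \<in> minus_i_eigenspace (I p). \<forall>w. complex_bilinear_ext (\<sigma> p) z w = 0) \<and>
     (\<forall>p. \<forall>z \<in> plus_i_eigenspace (I p).
        (\<forall>w \<in> plus_i_eigenspace (I p). complex_bilinear_ext (\<sigma> p) z w = 0) \<longrightarrow> z = 0)"


section \<open>Generalized complex structures on \<open>T \<oplus> T\<^sup>*\<close>\<close>

definition gen_inner :: "'e::euclidean_space gtangent \<Rightarrow> 'e gtangent \<Rightarrow> real" where
  "gen_inner w z = (snd w (fst z) + snd z (fst w)) / 2"

definition gen_almost_complex_structure ::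
    "('m, 'e::euclidean_space) chart set \<Rightarrow> ('m \<Rightarrow> 'e gtangent \<Rightarrow> 'e gtangent) \<Rightarrow> bool" where
  "gen_almost_complex_structure A J \<longleftrightarrow>
     smooth_gen_endo A J \<and>
     (\<forall>p w z. gen_inner (J p w) (J p z) = gen_inner w z) \<and>
     (\<forall>p w. J p (J p w) = - w)"

definition gen_complex_structure ::
    "('m::topological_space, 'e::euclidean_space) chart set \<Rightarrow>
     ('m \<Rightarrow> 'e gtangent \<Rightarrow> 'e gtangent) \<Rightarrow> bool" where
  "gen_complex_structure A J \<longleftrightarrow>
     gen_almost_complex_structure A J \<and>
     involutive (smooth_gen_section_on A) (courant_bracket A) (\<lambda>p. plus_i_eigenspace (J p))"

definition J_complex ::
    "('m \<Rightarrow> 'e::euclidean_space \<Rightarrow>\<^sub>L 'e) \<Rightarrow> 'm \<Rightarrow> 'e gtangent \<Rightarrow> 'e gtangent" where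
  "J_complex I p w = (- I p (fst w), snd w o\<^sub>L I p)"

definition J_symplectic ::
    "('m, 'e::euclidean_space, real) form2 \<Rightarrow> 'm \<Rightarrow> 'e gtangent \<Rightarrow> 'e gtangent" where
  "J_symplectic \<omega> p w = (- inv (blinfun_apply (\<omega> p)) (snd w), \<omega> p (fst w))"

definition J_interp ::
    "('m \<Rightarrow> 'e::euclidean_space \<Rightarrow>\<^sub>L 'e) \<Rightarrow> ('m, 'e, real) form2 \<Rightarrow> real \<Rightarrow>
     'm \<Rightarrow> 'e gtangent \<Rightarrow> 'e gtangent" where
  "J_interp I \<omega> t p w = sin t *\<^sub>R J_complex I p w + cos t *\<^sub>R J_symplectic \<omega> p w"

end

theory Submission
  imports Defs
begin

text \<open>
  Type \<open>(2,0)\<close> of \<open>\<sigma>\<close> says \<open>\<sigma>(I u, v) = i \<sigma>(u, v)\<close>. Together with the nondegeneracy of \<open>\<sigma>\<close> this makes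
  \<open>\<omega>J\<close> nondegenerate and the two endomorphisms anticommute, so \<open>J\<^sub>t\<close> squares to \<open>-1\<close>. For
  \<open>cos t \<noteq> 0\<close> the \<open>+i\<close>-eigenbundle is the graph of the closed complex 2-form
  \<open>tan t \<omega>K - (i / cos t) \<omega>J\<close>, and graphs of closed 2-forms are Courant involutive. For
  \<open>t = \<pi>/2\<close> the eigenbundle is \<open>T\<^sup>0\<^sup>,\<^sup>1 \<oplus> T\<^sup>*\<^sup>1\<^sup>,\<^sup>0\<close>, which is involutive because the Nijenhuis tensor of \<open>I\<close>
  vanishes; this in turn follows from \<open>d\<sigma> = 0\<close>, so that all computations stay pointwise in a single
  chart and no vector fields have to be constructed on the manifold.
\<close>

section \<open>Calculus of smooth maps\<close>

text \<open>The coefficients of the graph come from the vector component of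
  \<open>J_t (Z + \<zeta>) = i (Z + \<zeta>)\<close>: applying \<open>\<omega>J\<close> turns it
  into \<open>sin t \<omega>K Z - cos t \<zeta> = i \<omega>J Z\<close>, which is then solved for
  \<open>\<zeta>\<close>. They blow up as t tends to \<open>pi/2\<close>, where the eigenbundle is
  no longer a graph over T; hence the separate argument there. Two features of the formal setting
  shape the rest. The inverse of \<open>\<omega>J\<close> enters \<open>J_t\<close> pointwise, while
  the forms are only known to be smooth after evaluation on fixed vectors; smoothness of
  \<open>J_t\<close> therefore needs operator-valued smoothness and the differentiation of operator
  inversion. Moreover, values are stored in a base chart that may jump, so nothing can be
  differentiated in stored form: each tensor is rewritten in one fixed chart, where
  \<open>J_t\<close> keeps its shape, and the bracket at a point is read off in the base chart of
  that point, whose Jacobian to itself is the identity. Complex sections are pairs of real ones, so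
  each complex identity appears as two real ones.\<close>

lemma times_differentiable_on_cong:
  fixes f g :: "'a::real_normed_vector \<Rightarrow> 'b::real_normed_vector"
  assumes "open S" "\<And>x. x \<in> S \<Longrightarrow> f x = g x" "times_differentiable_on n S f"
  shows "times_differentiable_on n S g"
  using assms(2,3)
proof (induction n arbitrary: f g)
  case 0
  then show ?case by (simp cong: continuous_on_cong)
next
  case (Suc n)
  have der: "(g has_derivative frechet_derivative f (at x)) (at x)" if "x \<in> S" for x
  proof (rule has_derivative_transform_within_open[OF _ \<open>open S\<close> that])
    show "(f has_derivative frechet_derivative f (at x)) (at x)"
      using Suc.prems(2) that frechet_derivative_works by auto
  qed (use Suc.prems in auto)
  have eq: "frechet_derivative g (at x) = frechet_derivative f (at x)" if "x \<in> S" for x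
    using der[OF that] frechet_derivative_at by metis
  have "times_differentiable_on n S (\<lambda>x. frechet_derivative g (at x) v)" for v
    by (rule Suc.IH[of "\<lambda>x. frechet_derivative f (at x) v"]) (use eq Suc.prems in auto)
  with der show ?case by (auto simp: differentiable_def)
qed

lemma times_differentiable_on_SucD:
  "times_differentiable_on (Suc n) S f \<Longrightarrow> times_differentiable_on n S f"
proof (induction n arbitrary: f)
  case 0
  then show ?case
    by (auto intro!: continuous_at_imp_continuous_on differentiable_imp_continuous_within)
next
  case (Suc n)
  then show ?case by (metis times_differentiable_on.simps(2))
qed

text \<open>Derivatives are unique, so any explicit formula may stand in for
  \<open>frechet_derivative\<close>; openness of \<open>S\<close> transfers differentiability
  between the two. This drives all inductions below.\<close>

lemma times_differentiable_on_SucI: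
  assumes "open S" "\<And>x. x \<in> S \<Longrightarrow> (f has_derivative f' x) (at x)"
    and "\<And>v. times_differentiable_on n S (\<lambda>x. f' x v)"
  shows "times_differentiable_on (Suc n) S f"
proof -
  have "f' x = frechet_derivative f (at x)" if "x \<in> S" for x
    using assms(2)[OF that] by (rule frechet_derivative_at)
  then have "times_differentiable_on n S (\<lambda>x. frechet_derivative f (at x) v)" for v
    by (intro times_differentiable_on_cong[OF assms(1) _ assms(3)[of v]]) auto
  with assms(2) show ?thesis by (auto simp: differentiable_def)
qed

lemma times_differentiable_on_has_derivative:
  assumes "times_differentiable_on (Suc n) S f" "x \<in> S"
  shows "(f has_derivative frechet_derivative f (at x)) (at x)"
  using assms frechet_derivative_works by auto

lemma times_differentiable_on_const:
  "open S \<Longrightarrow> times_differentiable_on n S (\<lambda>x. c)"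
proof (induction n arbitrary: c)
  case (Suc n)
  show ?case
    by (rule times_differentiable_on_SucI[OF Suc.prems, where f' = "\<lambda>x h. 0"])
       (use Suc in auto)
qed auto

lemma times_differentiable_on_add:
  assumes "open S"
  shows "times_differentiable_on n S f \<Longrightarrow> times_differentiable_on n S g \<Longrightarrow>
    times_differentiable_on n S (\<lambda>x. f x + g x)"
proof (induction n arbitrary: f g)
  case 0
  then show ?case by (auto intro: continuous_on_add)
next
  case (Suc n)
  show ?case
    by (rule times_differentiable_on_SucI[OF assms,
          where f' = "\<lambda>x h. frechet_derivative f (at x) h + frechet_derivative g (at x) h"])
       (use Suc in \<open>auto intro!: has_derivative_add simp flip: frechet_derivative_works\<close>)
qed

lemma times_differentiable_on_bounded_linear:
  assumes "open S" "bounded_linear h"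
  shows "times_differentiable_on n S f \<Longrightarrow> times_differentiable_on n S (\<lambda>x. h (f x))"
proof (induction n arbitrary: f)
  case 0
  then show ?case using bounded_linear.continuous_on[OF assms(2)] by auto
next
  case (Suc n)
  show ?case
    by (rule times_differentiable_on_SucI[OF assms(1),
          where f' = "\<lambda>x v. h (frechet_derivative f (at x) v)"])
       (use Suc in \<open>auto intro!: bounded_linear.has_derivative[OF assms(2)]
          simp flip: frechet_derivative_works\<close>)
qed

lemma times_differentiable_on_bounded_bilinear:
  assumes "open S" "bounded_bilinear h"
  shows "times_differentiable_on n S f \<Longrightarrow> times_differentiable_on n S g \<Longrightarrow>
    times_differentiable_on n S (\<lambda>x. h (f x) (g x))"
proof (induction n arbitrary: f g)
  case 0
  then show ?case using bounded_bilinear.continuous_on[OF assms(2)] by auto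
next
  case (Suc n)
  show ?case
  proof (rule times_differentiable_on_SucI[OF assms(1)])
    show "((\<lambda>x. h (f x) (g x)) has_derivative
        (\<lambda>v. h (f x) (frechet_derivative g (at x) v) + h (frechet_derivative f (at x) v) (g x))) (at x)"
      if "x \<in> S" for x
      using Suc.prems that
      by (intro bounded_bilinear.FDERIV[OF assms(2)]) (auto intro: times_differentiable_on_has_derivative)
    show "times_differentiable_on n S
        (\<lambda>x. h (f x) (frechet_derivative g (at x) v) + h (frechet_derivative f (at x) v) (g x))" for v
      using Suc.prems times_differentiable_on_SucD[OF Suc.prems(1)]
        times_differentiable_on_SucD[OF Suc.prems(2)]
      by (intro times_differentiable_on_add[OF assms(1)] Suc.IH) auto
  qed
qed

lemma smooth_on_cong:
  "open S \<Longrightarrow> (\<And>x. x \<in> S \<Longrightarrow> f x = g x) \<Longrightarrow> smooth_on S f \<Longrightarrow> smooth_on S g"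
  unfolding smooth_on_def using times_differentiable_on_cong by blast

lemma smooth_on_const: "open S \<Longrightarrow> smooth_on S (\<lambda>x. c)"
  by (simp add: smooth_on_def times_differentiable_on_const)

lemma smooth_on_add:
  "open S \<Longrightarrow> smooth_on S f \<Longrightarrow> smooth_on S g \<Longrightarrow> smooth_on S (\<lambda>x. f x + g x)"
  by (simp add: smooth_on_def times_differentiable_on_add)

lemma smooth_on_bounded_linear:
  "open S \<Longrightarrow> bounded_linear h \<Longrightarrow> smooth_on S f \<Longrightarrow> smooth_on S (\<lambda>x. h (f x))"
  by (simp add: smooth_on_def times_differentiable_on_bounded_linear)

lemma smooth_on_imp_has_derivative:
  "smooth_on S f \<Longrightarrow> x \<in> S \<Longrightarrow> (f has_derivative frechet_derivative f (at x)) (at x)"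
  unfolding smooth_on_def using times_differentiable_on_has_derivative by blast

lemma smooth_on_sum:
  assumes "open S" "finite B" "\<And>b. b \<in> B \<Longrightarrow> smooth_on S (f b)"
  shows "smooth_on S (\<lambda>x. \<Sum>b\<in>B. f b x)"
  using assms(2,3)
  by (induction B rule: finite_induct)
     (auto intro!: smooth_on_const smooth_on_add assms(1))

lemma smooth_on_Pair:
  assumes "open S" "smooth_on S f" "smooth_on S g"
  shows "smooth_on S (\<lambda>x. (f x, g x))"
proof -
  have "smooth_on S (\<lambda>x. (f x, 0) + (0, g x))"
    by (intro smooth_on_add assms smooth_on_bounded_linear[where h = "\<lambda>a. (a, 0)"]
        smooth_on_bounded_linear[where h = "\<lambda>a. (0, a)"] bounded_linear_Pair
        bounded_linear_ident bounded_linear_zero)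
  then show ?thesis by simp
qed

text \<open>The domain of the operators is finite-dimensional, so \<open>f x\<close> is a finite sum
  of rank-one operators, each depending linearly on the value \<open>f x b\<close> at a basis
  vector. Applied twice, it handles 2-forms, which are operators with operator values.\<close>

lemma smooth_on_blinfun_componentwise:
  fixes f :: "'a::real_normed_vector \<Rightarrow> 'c::euclidean_space \<Rightarrow>\<^sub>L 'b::real_normed_vector"
  assumes "open S" "\<And>u. smooth_on S (\<lambda>x. f x u)"
  shows "smooth_on S f"
proof -
  have bl: "bounded_linear (\<lambda>z. blinfun_scaleR_left z o\<^sub>L blinfun_inner_left b)"
    for b :: 'c
    by (intro bounded_linear_intros bounded_linear_blinfun_scaleR_left)
  have eq: "f x = (\<Sum>b\<in>Basis. blinfun_scaleR_left (f x b) o\<^sub>L blinfun_inner_left b)" for x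
  proof (rule blinfun_eqI)
    fix u :: 'c
    have "f x u = f x (\<Sum>b\<in>Basis. (u \<bullet> b) *\<^sub>R b)" by (simp add: euclidean_representation)
    also have "\<dots> = (\<Sum>b\<in>Basis. (u \<bullet> b) *\<^sub>R f x b)"
      by (simp add: blinfun.bilinear_simps)
    finally show "f x u = (\<Sum>b\<in>Basis. blinfun_scaleR_left (f x b) o\<^sub>L blinfun_inner_left b) u"
      by (simp add: blinfun.sum_left inner_commute)
  qed
  have "smooth_on S (\<lambda>x. \<Sum>b\<in>Basis. blinfun_scaleR_left (f x b) o\<^sub>L blinfun_inner_left b)"
    by (intro smooth_on_sum assms smooth_on_bounded_linear[OF _ bl]) auto
  then show ?thesis using eq by (simp add: eq[symmetric])
qed

section \<open>Smooth dependence of operator inverses\<close>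

lemma blinfun_inverse_diff:
  assumes "W y o\<^sub>L M y = id_blinfun" "M x o\<^sub>L W x = id_blinfun"
  shows "W y - W x = W y o\<^sub>L ((M x - M y) o\<^sub>L W x)"
proof (rule blinfun_eqI)
  fix v
  have "M x (W x v) = v" "W y (M y (W x v)) = W x v"
    using assms by (metis blinfun_apply_blinfun_compose blinfun_apply_id_blinfun)+
  then show "(W y - W x) v = (W y o\<^sub>L ((M x - M y) o\<^sub>L W x)) v"
    by (simp add: blinfun.diff_left blinfun.diff_right)
qed

text \<open>The resolvent identity
  \<open>W y - W x = W y o\<^sub>L ((M x - M y) o\<^sub>L W x)\<close> bounds the increment of
  \<open>W\<close>, except that the bound still contains the unknown
  \<open>norm (W y)\<close>.\<close>

lemma continuous_on_blinfun_inverse: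
  fixes M :: "'a::real_normed_vector \<Rightarrow> 'c::real_normed_vector \<Rightarrow>\<^sub>L 'd::real_normed_vector"
  assumes "continuous_on S M"
    and WM: "\<And>x. x \<in> S \<Longrightarrow> W x o\<^sub>L M x = id_blinfun"
    and MW: "\<And>x. x \<in> S \<Longrightarrow> M x o\<^sub>L W x = id_blinfun"
  shows "continuous_on S W"
proof -
  have "continuous (at x within S) W" if x: "x \<in> S" for x
  proof -
    let ?F = "at x within S"
    let ?d = "\<lambda>y. norm (M x - M y)"
    let ?K = "norm (W x)"
    have "(M \<longlongrightarrow> M x) ?F" using assms(1) x by (simp add: continuous_on_def)
    then have "((\<lambda>y. norm (M x - M y)) \<longlongrightarrow> norm (M x - M x)) ?F"
      by (intro tendsto_intros)
    then have d0: "(?d \<longlongrightarrow> 0) ?F" by simp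
    have bound: "norm (W y - W x) \<le> norm (W y) * ?d y * ?K" if "y \<in> S" for y
      unfolding blinfun_inverse_diff[of W y M x, OF WM[OF that] MW[OF x]]
      unfolding mult.assoc
      by (rule order_trans[OF norm_blinfun_compose mult_left_mono[OF norm_blinfun_compose norm_ge_zero]])
    \<comment> \<open>The threshold 1/2 allows absorption: \<open>norm (W y)\<close> is at most
      \<open>?K\<close> plus half of itself, hence at most \<open>2 * ?K\<close> near
      \<open>x\<close>.\<close>
    have "\<forall>\<^sub>F y in ?F. ?d y * ?K < 1/2"
      using tendsto_mult_left_zero[OF d0, of ?K] by (rule order_tendstoD(2)) simp
    moreover have "\<forall>\<^sub>F y in ?F. y \<in> S" by (simp add: eventually_at_filter)
    ultimately have "\<forall>\<^sub>F y in ?F. norm (W y - W x) \<le> 2 * ?K * ?d y * ?K"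
    proof eventually_elim
      case (elim y)
      have "norm (W y) \<le> ?K + norm (W y - W x)" by (rule norm_triangle_sub)
      also have "norm (W y - W x) \<le> norm (W y) * (?d y * ?K)" using bound[OF elim(2)] by (simp add: mult.assoc)
      also have "\<dots> \<le> norm (W y) * (1/2)" using elim(1) by (intro mult_left_mono) auto
      finally have "norm (W y) \<le> 2 * ?K" by simp
      then show ?case using bound[OF elim(2)]
        by (meson mult_right_mono norm_ge_zero order_trans)
    qed
    moreover have "((\<lambda>y. 2 * ?K * ?d y * ?K) \<longlongrightarrow> 0) ?F"
      using tendsto_mult_left_zero[OF tendsto_mult_right_zero[OF d0, of "2 * ?K"], of ?K] by simp
    ultimately have "((\<lambda>y. W y - W x) \<longlongrightarrow> 0) ?F" by (rule Lim_null_comparison)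
    then show ?thesis by (simp add: continuous_within LIM_zero_iff)
  qed
  then show ?thesis by (simp add: continuous_on_eq_continuous_within)
qed

text \<open>By the resolvent identity \<open>W y - W x = W y o\<^sub>L G y\<close>, where
  \<open>G\<close> vanishes at \<open>x\<close> and is differentiable there. Replacing the factor
  \<open>W y\<close> by \<open>W x\<close> changes this only to higher order, because
  \<open>W\<close> is continuous.\<close>

lemma has_derivative_blinfun_inverse:
  fixes M :: "'a::real_normed_vector \<Rightarrow> 'c::real_normed_vector \<Rightarrow>\<^sub>L 'd::real_normed_vector"
  assumes "open S" "x \<in> S" and cont: "continuous_on S W"
    and M': "(M has_derivative M') (at x)"
    and WM: "\<And>x. x \<in> S \<Longrightarrow> W x o\<^sub>L M x = id_blinfun"
    and MW: "\<And>x. x \<in> S \<Longrightarrow> M x o\<^sub>L W x = id_blinfun"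
  shows "(W has_derivative (\<lambda>h. - (W x o\<^sub>L M' h o\<^sub>L W x))) (at x)"
proof -
  define G where "G = (\<lambda>y. (M x - M y) o\<^sub>L W x)"
  define G' where "G' = (\<lambda>h. - (M' h o\<^sub>L W x))"
  have G': "(G has_derivative G') (at x)"
    unfolding G_def G'_def
    by (rule derivative_eq_intros M' bounded_bilinear.FDERIV[OF bounded_bilinear_blinfun_compose] | simp)+
       (simp add: bounded_bilinear.minus_left[OF bounded_bilinear_blinfun_compose])
  then have bl: "bounded_linear G'" by (rule has_derivative_bounded_linear)
  obtain K where K: "\<And>h. norm (G' h) \<le> norm h * K"
    using bounded_linear.bounded[OF bl] by blast
  let ?e = "\<lambda>y. norm (G y - G' (y - x)) / norm (y - x)"
  have "G x = 0" by (simp add: G_def)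
  then have e0: "(?e \<longlongrightarrow> 0) (at x)"
    using G' by (simp add: has_derivative_iff_norm)
  have contW: "(W \<longlongrightarrow> W x) (at x)"
    using cont \<open>open S\<close> \<open>x \<in> S\<close> by (simp add: continuous_on_eq_continuous_at continuous_at)
  have "((\<lambda>y. norm (W y - W x)) \<longlongrightarrow> norm (W x - W x)) (at x)"
    by (intro tendsto_intros contW)
  then have W0: "((\<lambda>y. norm (W y - W x)) \<longlongrightarrow> 0) (at x)" by simp
  \<comment> \<open>This majorant of the remainder quotient uses that
    \<open>norm (G y) / norm (y - x)\<close> is at most \<open>?e y + K\<close>: linearization error
    plus a bound for the linear part.\<close>
  have lim: "((\<lambda>y. norm (W y - W x) * (?e y + K) + norm (W x) * ?e y) \<longlongrightarrow> 0) (at x)"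
    using tendsto_add[OF tendsto_mult[OF W0 tendsto_add[OF e0 tendsto_const[of K]]]
        tendsto_mult[OF tendsto_const[of "norm (W x)"] e0]] by simp
  let ?r = "\<lambda>y. norm (W y - W x - (W x o\<^sub>L G' (y - x))) / norm (y - x)"
  have ident: "W y - W x = W y o\<^sub>L G y" if "y \<in> S" for y
    unfolding G_def by (rule blinfun_inverse_diff[of W y M x, OF WM[OF that] MW[OF \<open>x \<in> S\<close>]])
  have "\<forall>\<^sub>F y in at x. y \<in> S" using assms(1,2) by (rule eventually_at_in_open')
  moreover have "\<forall>\<^sub>F y in at x. y \<noteq> x" by (simp add: eventually_at_filter)
  ultimately have "\<forall>\<^sub>F y in at x. norm (?r y) \<le> norm (W y - W x) * (?e y + K) + norm (W x) * ?e y"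
  proof eventually_elim
    case (elim y)
    have pos: "norm (y - x) > 0" using elim by simp
    have "W y - W x - (W x o\<^sub>L G' (y - x)) = ((W y - W x) o\<^sub>L G y) + (W x o\<^sub>L (G y - G' (y - x)))"
      by (simp add: bounded_bilinear.diff_left[OF bounded_bilinear_blinfun_compose]
          bounded_bilinear.diff_right[OF bounded_bilinear_blinfun_compose] flip: ident[OF elim(1)])
    then have "norm (W y - W x - (W x o\<^sub>L G' (y - x)))
        \<le> norm ((W y - W x) o\<^sub>L G y) + norm (W x o\<^sub>L (G y - G' (y - x)))"
      by (metis norm_triangle_ineq)
    also have "\<dots> \<le> norm (W y - W x) * norm (G y) + norm (W x) * norm (G y - G' (y - x))"
      by (intro add_mono norm_blinfun_compose)
    also have "norm (G y) \<le> norm (G y - G' (y - x)) + norm (y - x) * K"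
      using K[of "y - x"] norm_triangle_sub[of "G y" "G' (y - x)"] by linarith
    finally have "norm (W y - W x - (W x o\<^sub>L G' (y - x))) \<le>
        norm (W y - W x) * (norm (G y - G' (y - x)) + norm (y - x) * K)
        + norm (W x) * norm (G y - G' (y - x))"
      by (simp add: mult_left_mono)
    then have "?r y \<le> (norm (W y - W x) * (norm (G y - G' (y - x)) + norm (y - x) * K)
        + norm (W x) * norm (G y - G' (y - x))) / norm (y - x)"
      by (rule divide_right_mono) simp
    also have "\<dots> = norm (W y - W x) * (?e y + K) + norm (W x) * ?e y"
      using pos by (simp add: field_simps)
    finally show ?case by simp
  qed
  from Lim_null_comparison[OF this lim] have "(?r \<longlongrightarrow> 0) (at x)" .
  moreover have "bounded_linear (\<lambda>h. W x o\<^sub>L G' h)"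
    by (rule bounded_linear_compose[OF bounded_bilinear.bounded_linear_right[OF bounded_bilinear_blinfun_compose] bl])
  ultimately have "(W has_derivative (\<lambda>h. W x o\<^sub>L G' h)) (at x)"
    by (simp add: has_derivative_iff_norm)
  moreover have "(W x o\<^sub>L G' h) = - (W x o\<^sub>L M' h o\<^sub>L W x)" for h
    by (rule blinfun_eqI) (simp add: G'_def blinfun.bilinear_simps)
  ultimately show ?thesis by simp
qed

text \<open>The derivative of \<open>W\<close> is a product of \<open>W\<close>, the derivative of
  \<open>M\<close> and \<open>W\<close> again, so n-fold differentiability of \<open>W\<close>
  yields the next order; continuity starts the induction.\<close>

lemma smooth_on_blinfun_inverse:
  fixes M :: "'a::real_normed_vector \<Rightarrow> 'c::real_normed_vector \<Rightarrow>\<^sub>L 'd::real_normed_vector"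
  assumes "open S" "smooth_on S M"
    and WM: "\<And>x. x \<in> S \<Longrightarrow> W x o\<^sub>L M x = id_blinfun"
    and MW: "\<And>x. x \<in> S \<Longrightarrow> M x o\<^sub>L W x = id_blinfun"
  shows "smooth_on S W"
proof -
  have M: "times_differentiable_on n S M" for n
    using assms(2) by (simp add: smooth_on_def)
  have "times_differentiable_on n S W" for n
  proof (induction n)
    case 0
    then show ?case using continuous_on_blinfun_inverse[OF _ WM MW] M[of 0] by simp
  next
    case (Suc n)
    have cont: "continuous_on S W"
      using continuous_on_blinfun_inverse[OF _ WM MW] M[of 0] by simp
    show ?case
    proof (rule times_differentiable_on_SucI[OF assms(1)])
      show "(W has_derivative (\<lambda>v. - (W x o\<^sub>L frechet_derivative M (at x) v o\<^sub>L W x))) (at x)" if "x \<in> S" for x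
        by (rule has_derivative_blinfun_inverse[OF assms(1) that cont _ WM MW])
           (use times_differentiable_on_has_derivative[OF M that] in auto)
      have "times_differentiable_on n S (\<lambda>x. frechet_derivative M (at x) v)" for v
        using M[of "Suc n"] by simp
      then show "times_differentiable_on n S (\<lambda>x. - (W x o\<^sub>L frechet_derivative M (at x) v o\<^sub>L W x))" for v
        by (intro times_differentiable_on_bounded_linear[OF assms(1) bounded_linear_minus[OF bounded_linear_ident]]
            times_differentiable_on_bounded_bilinear[OF assms(1) bounded_bilinear_blinfun_compose] Suc)
    qed
  qed
  then show ?thesis by (simp add: smooth_on_def)
qed

section \<open>Linear algebra at a point\<close>

text \<open>A dimension count: the Riesz map \<open>r\<close> identifies the dual with
  \<open>'e\<close>, so that \<open>M\<close> becomes an injective endomorphism \<open>g\<close> of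
  a Euclidean space, hence a bijection. The last conclusion ties the operator \<open>W\<close> to
  the bare \<open>inv\<close> in \<open>J_symplectic\<close>.\<close>

lemma blinfun_dual_inverse:
  fixes M :: "'e::euclidean_space \<Rightarrow>\<^sub>L 'e \<Rightarrow>\<^sub>L real"
  assumes inj: "\<And>v. M v = 0 \<Longrightarrow> v = 0"
  obtains W where "W o\<^sub>L M = id_blinfun" "M o\<^sub>L W = id_blinfun" "inv (blinfun_apply M) = blinfun_apply W"
proof -
  define r :: "('e \<Rightarrow>\<^sub>L real) \<Rightarrow> 'e" where "r = (\<lambda>\<zeta>. \<Sum>b\<in>Basis. \<zeta> b *\<^sub>R b)"
  have r: "bounded_linear r"
    unfolding r_def by (intro bounded_linear_intros)
  have r_inner: "r \<zeta> \<bullet> v = \<zeta> v" for \<zeta> v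
  proof -
    have "\<zeta> v = \<zeta> (\<Sum>b\<in>Basis. (v \<bullet> b) *\<^sub>R b)" by (simp add: euclidean_representation)
    also have "\<dots> = (\<Sum>b\<in>Basis. (v \<bullet> b) * \<zeta> b)" by (simp add: blinfun.sum_right blinfun.scaleR_right)
    finally show ?thesis by (simp add: r_def inner_sum_right inner_commute mult.commute)
  qed
  have r_eq: "\<zeta> = \<eta>" if "r \<zeta> = r \<eta>" for \<zeta> \<eta>
    using that by (intro blinfun_eqI) (metis r_inner)
  define g where "g v = r (M v)" for v
  have g: "bounded_linear g"
    unfolding g_def by (rule bounded_linear_compose[OF r blinfun.bounded_linear_right])
  then have lin: "linear g" by (rule bounded_linear.linear)
  have "inj g"
    unfolding linear_injective_0[OF lin] g_def
    using inj r_eq linear_0[OF bounded_linear.linear[OF r]] by metis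
  then have "bij g"
    using linear_injective_imp_surjective[OF lin] by (simp add: bij_def)
  then have inv_lin: "linear (inv g)"
    by (intro inj_linear_imp_inv_linear lin) (simp add: bij_is_inj)
  define W where "W = Blinfun (\<lambda>\<zeta>. inv g (r \<zeta>))"
  have W: "W \<zeta> = inv g (r \<zeta>)" for \<zeta>
    unfolding W_def
    by (subst bounded_linear_Blinfun_apply)
       (use inv_lin r in \<open>auto intro!: bounded_linear_compose[where g = r] simp: linear_conv_bounded_linear\<close>)
  have WM: "W (M v) = v" for v
    using \<open>bij g\<close> by (simp add: W flip: g_def) (simp add: bij_is_inj)
  have MW: "M (W \<zeta>) = \<zeta>" for \<zeta>
  proof (rule r_eq)
    show "r (M (W \<zeta>)) = r \<zeta>"
      unfolding W using \<open>bij g\<close> by (simp flip: g_def add: bij_is_surj surj_f_inv_f)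
  qed
  show ?thesis
  proof
    show "W o\<^sub>L M = id_blinfun" "M o\<^sub>L W = id_blinfun"
      by (auto intro!: blinfun_eqI simp: WM MW)
    show "inv (blinfun_apply M) = blinfun_apply W"
      by (rule inv_equality) (auto simp: WM MW)
  qed
qed

text \<open>The assumptions \<open>\<omega>J_I\<close> and \<open>\<omega>K_I\<close> are the real
  and imaginary parts of \<open>\<sigma>(I u, v) = i \<sigma>(u, v)\<close>. The type of
  \<open>p\<close> is left free, so that the locale serves at points of the manifold and at
  coordinate points alike.\<close>

locale holomorphic_symplectic_at =
  fixes I :: "'m \<Rightarrow> 'e::euclidean_space \<Rightarrow>\<^sub>L 'e" and \<omega>J \<omega>K :: "('m, 'e, real) form2" and p :: 'm
  assumes I_I: "I p (I p v) = - v"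
    and \<omega>J_self: "\<omega>J p v v = 0" and \<omega>K_self: "\<omega>K p v v = 0"
    and \<omega>J_I: "\<omega>J p (I p u) v = - \<omega>K p u v"
    and \<omega>K_I: "\<omega>K p (I p u) v = \<omega>J p u v"
    and nondeg: "\<omega>J p u = 0 \<Longrightarrow> u = 0"
begin

lemma \<omega>J_antisym: "\<omega>J p u v = - \<omega>J p v u"
  using \<omega>J_self[of "u + v"] by (simp add: blinfun.add_left blinfun.add_right \<omega>J_self)

lemma \<omega>K_antisym: "\<omega>K p u v = - \<omega>K p v u"
  using \<omega>K_self[of "u + v"] by (simp add: blinfun.add_left blinfun.add_right \<omega>K_self)

lemma \<omega>J_I_right: "\<omega>J p u (I p v) = - \<omega>K p u v"
  by (metis \<omega>J_I \<omega>J_antisym \<omega>K_antisym)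

lemma \<omega>K_I_right: "\<omega>K p u (I p v) = \<omega>J p u v"
  by (metis \<omega>K_I \<omega>J_antisym \<omega>K_antisym)

text \<open>The inverse of \<open>\<omega>J p\<close> as a bounded operator rather than a bare
  function, so that its smooth dependence on the point can be stated in the operator space.\<close>

definition "W = (SOME W. W o\<^sub>L \<omega>J p = id_blinfun \<and> \<omega>J p o\<^sub>L W = id_blinfun \<and>
    inv (blinfun_apply (\<omega>J p)) = blinfun_apply W)"

lemma W: "W o\<^sub>L \<omega>J p = id_blinfun" "\<omega>J p o\<^sub>L W = id_blinfun"
    "inv (blinfun_apply (\<omega>J p)) = blinfun_apply W"
proof -
  have "\<exists>W. W o\<^sub>L \<omega>J p = id_blinfun \<and> \<omega>J p o\<^sub>L W = id_blinfun \<and>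
    inv (blinfun_apply (\<omega>J p)) = blinfun_apply W"
    by (rule blinfun_dual_inverse[of "\<omega>J p"]) (use nondeg in auto)
  from someI_ex[OF this] show "W o\<^sub>L \<omega>J p = id_blinfun" "\<omega>J p o\<^sub>L W = id_blinfun"
    "inv (blinfun_apply (\<omega>J p)) = blinfun_apply W"
    by (auto simp: W_def)
qed

lemma W_\<omega>J: "W (\<omega>J p v) = v" and \<omega>J_W: "\<omega>J p (W \<zeta>) = \<zeta>"
  by (metis W(1) blinfun_apply_blinfun_compose blinfun_apply_id_blinfun,
      metis W(2) blinfun_apply_blinfun_compose blinfun_apply_id_blinfun)

lemma \<omega>J_inj: "\<omega>J p u = \<omega>J p v \<longleftrightarrow> u = v"
  by (metis W_\<omega>J)

text \<open>Together with \<open>W_compose_I\<close>, these are the two off-diagonal blocks of the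
  statement that \<open>J_complex\<close> and \<open>J_symplectic\<close> anticommute.\<close>

lemma \<omega>J_I_compose: "\<omega>J p (I p u) = \<omega>J p u o\<^sub>L I p"
  by (rule blinfun_eqI) (simp add: \<omega>J_I \<omega>J_I_right)

lemma W_compose_I: "W (\<zeta> o\<^sub>L I p) = I p (W \<zeta>)"
  by (metis \<omega>J_I_compose \<omega>J_W W_\<omega>J)

lemma J_interp_eq:
  "J_interp I \<omega>J t p (u, \<zeta>) =
    (- (sin t *\<^sub>R I p u) - cos t *\<^sub>R W \<zeta>, sin t *\<^sub>R (\<zeta> o\<^sub>L I p) + cos t *\<^sub>R \<omega>J p u)"
  by (simp add: J_interp_def J_complex_def J_symplectic_def W)

lemma linear_J_interp: "linear (J_interp I \<omega>J t p)"
proof (rule linearI)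
  fix w z :: "'e gtangent" and r :: real
  obtain u \<zeta> v \<eta> where "w = (u, \<zeta>)" "z = (v, \<eta>)" by fastforce
  then show "J_interp I \<omega>J t p (w + z) = J_interp I \<omega>J t p w + J_interp I \<omega>J t p z"
    by (simp add: J_interp_eq algebra_simps blinfun.bilinear_simps
        bounded_bilinear.add_left[OF bounded_bilinear_blinfun_compose])
  show "J_interp I \<omega>J t p (r *\<^sub>R w) = r *\<^sub>R J_interp I \<omega>J t p w"
    using \<open>w = (u, \<zeta>)\<close>
    by (simp add: J_interp_eq algebra_simps blinfun.bilinear_simps
        bounded_bilinear.scaleR_left[OF bounded_bilinear_blinfun_compose])
qed

lemma J_interp_J_interp: "J_interp I \<omega>J t p (J_interp I \<omega>J t p w) = - w"
proof -
  obtain u \<zeta> where w: "w = (u, \<zeta>)" by fastforce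
  let ?s = "sin t" and ?c = "cos t"
  have s: "?s * ?s = 1 - ?c * ?c"
    using sin_cos_squared_add[of t] by (simp add: power2_eq_square)
  have "?s *\<^sub>R ?s *\<^sub>R u + ?c *\<^sub>R ?c *\<^sub>R u = u"
    by (simp add: s scaleR_diff_left)
  moreover have "?s *\<^sub>R ?s *\<^sub>R \<zeta> + ?c *\<^sub>R ?c *\<^sub>R \<zeta> = \<zeta>"
    by (simp add: s scaleR_diff_left)
  moreover have "\<zeta> o\<^sub>L I p o\<^sub>L I p = - \<zeta>"
    by (rule blinfun_eqI) (simp add: I_I blinfun.bilinear_simps)
  ultimately show ?thesis
    by (simp add: w J_interp_eq blinfun.bilinear_simps I_I W_compose_I \<omega>J_I_compose W_\<omega>J \<omega>J_W
        bounded_bilinear.add_left[OF bounded_bilinear_blinfun_compose]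
        bounded_bilinear.scaleR_left[OF bounded_bilinear_blinfun_compose] algebra_simps)
qed

text \<open>A skew endomorphism with square -1 is orthogonal. Skewness comes from the shape of
  \<open>J_complex\<close> and from the antisymmetry of \<open>\<omega>J\<close>, which its inverse
  \<open>W\<close> inherits.\<close>

lemma gen_inner_J_interp:
  "gen_inner (J_interp I \<omega>J t p w) (J_interp I \<omega>J t p z) = gen_inner w z"
proof -
  have skew: "gen_inner (J_interp I \<omega>J t p w) z = - gen_inner w (J_interp I \<omega>J t p z)" for w z
  proof -
    obtain u \<zeta> v \<eta> where w: "w = (u, \<zeta>)" and z: "z = (v, \<eta>)" by fastforce
    have "\<eta> (W \<zeta>) = - \<zeta> (W \<eta>)"
      by (metis \<omega>J_W \<omega>J_antisym)
    then show ?thesis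
      by (simp add: w z gen_inner_def J_interp_eq blinfun.bilinear_simps field_simps \<omega>J_antisym[of v u])
  qed
  show ?thesis
    unfolding skew J_interp_J_interp by (simp add: gen_inner_def blinfun.bilinear_simps field_simps)
qed

lemma plus_i_eigenspace_J_interp:
  assumes "cos t \<noteq> 0"
  shows "((X, \<xi>), (Y, \<eta>)) \<in> plus_i_eigenspace (J_interp I \<omega>J t p) \<longleftrightarrow>
    \<xi> = tan t *\<^sub>R \<omega>K p X + (1 / cos t) *\<^sub>R \<omega>J p Y \<and>
    \<eta> = tan t *\<^sub>R \<omega>K p Y - (1 / cos t) *\<^sub>R \<omega>J p X"
    (is "?l \<longleftrightarrow> ?r")
proof -
  let ?s = "sin t" and ?c = "cos t"
  have JI: "\<omega>J p (I p u) = - \<omega>K p u" for u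
    by (rule blinfun_eqI) (simp add: \<omega>J_I blinfun.bilinear_simps)
  have "?l \<longleftrightarrow> J_interp I \<omega>J t p (X, \<xi>) = - (Y, \<eta>) \<and> J_interp I \<omega>J t p (Y, \<eta>) = (X, \<xi>)"
    by (simp add: plus_i_eigenspace_def)
  \<comment> \<open>Since \<open>J_t\<close> squares to -1, applying it to the real equation
    produces the imaginary one.\<close>
  also have "\<dots> \<longleftrightarrow> J_interp I \<omega>J t p (X, \<xi>) = - (Y, \<eta>)"
    by (metis J_interp_J_interp linear_J_interp linear_neg minus_minus)
  also have "\<dots> \<longleftrightarrow> ?r"
  proof
    assume eq: "J_interp I \<omega>J t p (X, \<xi>) = - (Y, \<eta>)"
    then have eq': "J_interp I \<omega>J t p (Y, \<eta>) = (X, \<xi>)"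
      by (metis J_interp_J_interp linear_J_interp linear_neg minus_minus)
    \<comment> \<open>Only the vector components are needed to find the covectors: applying
      \<open>\<omega>J\<close> removes \<open>W\<close> and turns \<open>I\<close> into
      \<open>\<omega>K\<close>.\<close>
    have 1: "?s *\<^sub>R I p X + ?c *\<^sub>R W \<xi> = Y"
      using eq by (simp add: J_interp_eq algebra_simps)
    have 2: "- (?s *\<^sub>R I p Y) - ?c *\<^sub>R W \<eta> = X"
      using eq' by (simp add: J_interp_eq)
    have "?c *\<^sub>R \<xi> = ?s *\<^sub>R \<omega>K p X + \<omega>J p Y"
      unfolding 1[symmetric] by (simp add: blinfun.bilinear_simps \<omega>J_W JI)
    moreover have "?c *\<^sub>R \<eta> = ?s *\<^sub>R \<omega>K p Y - \<omega>J p X"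
      unfolding 2[symmetric] by (simp add: blinfun.bilinear_simps \<omega>J_W JI)
    ultimately have "(1 / ?c) *\<^sub>R ?c *\<^sub>R \<xi> = (1 / ?c) *\<^sub>R (?s *\<^sub>R \<omega>K p X + \<omega>J p Y)"
      "(1 / ?c) *\<^sub>R ?c *\<^sub>R \<eta> = (1 / ?c) *\<^sub>R (?s *\<^sub>R \<omega>K p Y - \<omega>J p X)"
      by simp_all
    then show ?r
      using assms by (simp add: tan_def scaleR_add_right scaleR_diff_right)
  next
    assume ?r
    then have \<xi>: "\<xi> = (?s / ?c) *\<^sub>R \<omega>K p X + (1 / ?c) *\<^sub>R \<omega>J p Y"
      and \<eta>: "\<eta> = (?s / ?c) *\<^sub>R \<omega>K p Y - (1 / ?c) *\<^sub>R \<omega>J p X"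
      by (auto simp: tan_def)
    have "\<omega>J p (?s *\<^sub>R I p X + ?c *\<^sub>R W \<xi>) = \<omega>J p Y"
      using assms by (simp add: blinfun.bilinear_simps \<omega>J_W JI \<xi> algebra_simps)
    then have "- (?s *\<^sub>R I p X) - ?c *\<^sub>R W \<xi> = - Y"
      by (simp add: \<omega>J_inj algebra_simps)
    moreover have "?s *\<^sub>R (\<xi> o\<^sub>L I p) + ?c *\<^sub>R \<omega>J p X = - \<eta>"
    proof (rule blinfun_eqI)
      fix v
      have "?s * ?s = 1 - ?c * ?c"
        using sin_cos_squared_add[of t] by (simp add: power2_eq_square)
      then have "?c * (?c * \<omega>J p X v) + ?s * (?s * \<omega>J p X v) = \<omega>J p X v"
        by (simp add: left_diff_distrib flip: mult.assoc)
      then show "(?s *\<^sub>R (\<xi> o\<^sub>L I p) + ?c *\<^sub>R \<omega>J p X) v = (- \<eta>) v"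
        using assms
        by (simp add: blinfun.bilinear_simps \<xi> \<eta> \<omega>K_I_right \<omega>J_I_right field_simps)
    qed
    ultimately show "J_interp I \<omega>J t p (X, \<xi>) = - (Y, \<eta>)"
      by (simp add: J_interp_eq)
  qed
  finally show ?thesis .
qed

end

text \<open>The vectors \<open>X + i I X\<close> have type (0,1) because \<open>J_complex\<close>
  acts on T by \<open>- I\<close>; the covectors \<open>\<xi> - i (\<xi> o\<^sub>L I)\<close> have
  type (1,0). The real parts \<open>X\<close> and \<open>\<xi>\<close> are free.\<close>

lemma plus_i_eigenspace_J_complex:
  fixes I :: "'m \<Rightarrow> 'e::euclidean_space \<Rightarrow>\<^sub>L 'e"
  assumes "\<And>v. I p (I p v) = - v"
  shows "((X, \<xi>), (Y, \<eta>)) \<in> plus_i_eigenspace (J_complex I p) \<longleftrightarrow>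
    Y = I p X \<and> \<eta> = - (\<xi> o\<^sub>L I p)"
proof -
  have "\<xi> o\<^sub>L I p o\<^sub>L I p = - \<xi>" for \<xi> :: "'e \<Rightarrow>\<^sub>L real"
    by (rule blinfun_eqI) (simp add: assms blinfun.bilinear_simps)
  then show ?thesis
    by (auto simp: plus_i_eigenspace_def J_complex_def assms blinfun.bilinear_simps
        bounded_bilinear.minus_left[OF bounded_bilinear_blinfun_compose])
qed

section \<open>Involutivity in a chart\<close>

text \<open>The Courant bracket in a chart: \<open>X, Y, \<eta>\<close> are the values at a point, \<open>X', Y', \<xi>', \<eta>'\<close> the
  derivatives there.\<close>

definition flat_lie :: "'e::euclidean_space \<Rightarrow> ('e \<Rightarrow> 'e) \<Rightarrow> 'e \<Rightarrow> ('e \<Rightarrow> 'e) \<Rightarrow> 'e" where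
  "flat_lie X X' Y Y' = Y' X - X' Y"

definition flat_courant_form ::
  "'e::euclidean_space \<Rightarrow> ('e \<Rightarrow> 'e) \<Rightarrow> ('e \<Rightarrow> 'e \<Rightarrow>\<^sub>L real) \<Rightarrow>
   'e \<Rightarrow> ('e \<Rightarrow>\<^sub>L real) \<Rightarrow> ('e \<Rightarrow> 'e \<Rightarrow>\<^sub>L real) \<Rightarrow> 'e \<Rightarrow> real" where
  "flat_courant_form X X' \<xi>' Y \<eta> \<eta>' v = \<eta>' X v + \<eta> (X' v) - (\<xi>' Y v - \<xi>' v Y)"

section \<open>Differentiating identities that hold on an open set\<close>

lemma has_derivative_unique_open:
  assumes "(f has_derivative f') (at x)" "(g has_derivative g') (at x)"
    and "open S" "x \<in> S" "\<And>y. y \<in> S \<Longrightarrow> f y = g y"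
  shows "f' h = g' h"
proof -
  have "(g has_derivative f') (at x)"
    by (rule has_derivative_transform_within_open[OF assms(1,3,4,5)])
  then show ?thesis using assms(2) has_derivative_unique by metis
qed

lemma has_derivative_blinfun_apply:
  assumes "(f has_derivative f') (at x)" "(g has_derivative g') (at x)"
  shows "((\<lambda>y. blinfun_apply (f y) (g y)) has_derivative (\<lambda>h. f x (g' h) + f' h (g x))) (at x)"
  by (rule bounded_bilinear.FDERIV[OF bounded_bilinear_blinfun_apply assms])

lemma has_derivative_blinfun_compose:
  assumes "(f has_derivative f') (at x)" "(g has_derivative g') (at x)"
  shows "((\<lambda>y. f y o\<^sub>L g y) has_derivative (\<lambda>h. (f x o\<^sub>L g' h) + (f' h o\<^sub>L g x))) (at x)"
  by (rule bounded_bilinear.FDERIV[OF bounded_bilinear_blinfun_compose assms])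

text \<open>The first-order data of a 2-form at one coordinate point: \<open>B' h\<close> is the
  derivative of \<open>B\<close> in direction \<open>h\<close>, so \<open>closed\<close> is
  \<open>dB = 0\<close> in coordinates.\<close>

locale closed_form_at =
  fixes S :: "'e::euclidean_space set" and x :: 'e and B :: "'e \<Rightarrow> 'e \<Rightarrow>\<^sub>L 'e \<Rightarrow>\<^sub>L real" and B'
  assumes S: "open S" "x \<in> S"
    and B: "(B has_derivative B') (at x)"
    and self: "\<And>y v. y \<in> S \<Longrightarrow> B y v v = 0"
    and closed: "\<And>u v w. B' u v w + B' v w u + B' w u v = 0"
begin

lemma antisym: "y \<in> S \<Longrightarrow> B y u v = - B y v u"
  using self[of y "u + v"] by (simp add: blinfun.add_left blinfun.add_right self)

lemma deriv_apply: "((\<lambda>y. B y u v) has_derivative (\<lambda>h. B' h u v)) (at x)"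
  using has_derivative_blinfun_apply[OF has_derivative_blinfun_apply[OF B has_derivative_const[of u]]
      has_derivative_const[of v]]
  by simp

lemma deriv_antisym: "B' h u v = - B' h v u"
  by (rule has_derivative_unique_open[OF deriv_apply has_derivative_minus[OF deriv_apply] S])
     (rule antisym)

text \<open>\<open>L\<^sub>X i\<^sub>Y B - i\<^sub>Y d i\<^sub>X B = i\<^bsub>[X,Y]\<^esub> B\<close> for a closed 2-form \<open>B\<close>.\<close>

lemma flat_courant_form_graph:
  "flat_courant_form X X' (\<lambda>h. B' h X + B x (X' h)) Y (B x Y) (\<lambda>h. B' h Y + B x (Y' h)) v
    = B x (flat_lie X X' Y Y') v"
  using closed[of X Y v] deriv_antisym[of Y v X] antisym[OF S(2), of Y "X' v"]
  by (simp add: flat_courant_form_def flat_lie_def blinfun.bilinear_simps)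

lemma deriv_graph:
  assumes "(X has_derivative X') (at x)"
  shows "((\<lambda>y. B y (X y)) has_derivative (\<lambda>h. B' h (X x) + B x (X' h))) (at x)"
  using has_derivative_blinfun_apply[OF B assms] by (simp add: add.commute)

end

locale holomorphic_symplectic_chart =
  J: closed_form_at S x \<omega>J J' + K: closed_form_at S x \<omega>K K'
  for S :: "'e::euclidean_space set" and x \<omega>J \<omega>K J' K' +
  fixes I :: "'e \<Rightarrow> 'e \<Rightarrow>\<^sub>L 'e" and I'
  assumes I: "(I has_derivative I') (at x)"
    and alg: "\<And>y. y \<in> S \<Longrightarrow> holomorphic_symplectic_at I \<omega>J \<omega>K y"
begin

text \<open>The product rule applied to \<open>\<omega>J_I\<close>, solved for the term with
  \<open>I'\<close>. Derivatives of \<open>I\<close> are thus traded for derivatives of the forms,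
  where closedness can be used; \<open>flat_K_deriv\<close> does the same for
  \<open>\<omega>K_I\<close>.\<close>

lemma flat_J_deriv: "\<omega>J x (I' h u) v = - K' h u v - J' h (I x u) v"
proof -
  have "((\<lambda>y. \<omega>J y (I y u)) has_derivative (\<lambda>h. J' h (I x u) + \<omega>J x (I' h u))) (at x)"
    by (rule J.deriv_graph) (use has_derivative_blinfun_apply[OF I has_derivative_const[of u]] in simp)
  from has_derivative_blinfun_apply[OF this has_derivative_const[of v]]
  have "((\<lambda>y. \<omega>J y (I y u) v) has_derivative (\<lambda>h. J' h (I x u) v + \<omega>J x (I' h u) v)) (at x)"
    by (simp add: blinfun.add_left)
  from has_derivative_unique_open[OF this has_derivative_minus[OF K.deriv_apply[of u v]] J.S, of h]
  show ?thesis using holomorphic_symplectic_at.\<omega>J_I[OF alg] by simp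
qed

lemma flat_K_deriv: "\<omega>K x (I' h u) v = J' h u v - K' h (I x u) v"
proof -
  have "((\<lambda>y. \<omega>K y (I y u)) has_derivative (\<lambda>h. K' h (I x u) + \<omega>K x (I' h u))) (at x)"
    by (rule K.deriv_graph) (use has_derivative_blinfun_apply[OF I has_derivative_const[of u]] in simp)
  from has_derivative_blinfun_apply[OF this has_derivative_const[of v]]
  have "((\<lambda>y. \<omega>K y (I y u) v) has_derivative (\<lambda>h. K' h (I x u) v + \<omega>K x (I' h u) v)) (at x)"
    by (simp add: blinfun.add_left)
  from has_derivative_unique_open[OF this J.deriv_apply[of u v] J.S, of h]
  show ?thesis using holomorphic_symplectic_at.\<omega>K_I[OF alg] by simp
qed

sublocale x: holomorphic_symplectic_at I \<omega>J \<omega>K x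
  by (rule alg[OF J.S(2)])

lemma deriv_I: "((\<lambda>y. I y u) has_derivative (\<lambda>h. I' h u)) (at x)"
  using has_derivative_blinfun_apply[OF I has_derivative_const[of u]] by simp

lemma I'_I: "I' h (I x u) = - I x (I' h u)"
proof -
  have "((\<lambda>y. I y (I y u)) has_derivative (\<lambda>h. I x (I' h u) + I' h (I x u))) (at x)"
    by (rule has_derivative_blinfun_apply[OF I deriv_I])
  from has_derivative_unique_open[OF this has_derivative_const[of "-u"] J.S, of h]
  show ?thesis using holomorphic_symplectic_at.I_I[OF alg] by (simp add: eq_neg_iff_add_eq_0 add.commute)
qed

text \<open>The kernel of the closed form \<open>\<omega>J + i \<omega>K\<close> is involutive. In real terms: the
  contraction of the Nijenhuis tensor with \<open>\<omega>J\<close> is a combination of values of \<open>d\<omega>J\<close> and \<open>d\<omega>K\<close>.\<close>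

lemma nijenhuis:
  "I x (I' (I x v) u) - I x (I' (I x u) v) = I' u v - I' v u"
proof -
  have "\<omega>J x (I x (I' (I x v) u) - I x (I' (I x u) v) - (I' u v - I' v u)) w = 0" for w
  proof -
    \<comment> \<open>Up to sign, these are the four terms in the imaginary part of
      \<open>d\<sigma>(u + i I u, v + i I v, w)\<close>, whose first two arguments have type
      (0,1).\<close>
    have closed: "J' (I x u) v w - J' v (I x u) w + J' w (I x u) v = 0"
      "J' (I x v) u w - J' u (I x v) w + J' w (I x v) u = 0"
      "K' (I x u) (I x v) w - K' (I x v) (I x u) w + K' w (I x u) (I x v) = 0"
      "K' u v w - K' v u w + K' w u v = 0"
      using J.closed[of "I x u" v w] J.deriv_antisym[of v w "I x u"]
        J.closed[of "I x v" u w] J.deriv_antisym[of u w "I x v"]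
        K.closed[of "I x u" "I x v" w] K.deriv_antisym[of "I x v" w "I x u"]
        K.closed[of u v w] K.deriv_antisym[of v w u]
      by linarith+
    \<comment> \<open>This and the next equation make the derivatives along \<open>w\<close> cancel,
      as they must since the contraction of \<open>\<sigma>\<close> with (0,1)-vectors vanishes
      identically.\<close>
    have "J' w (I x u) v = - K' w u v - \<omega>J x (I' w u) v"
      using flat_J_deriv[of w u v] by simp
    moreover have "K' w (I x u) (I x v) = - J' w (I x v) u - \<omega>J x (I' w u) v"
      using flat_K_deriv[of w u "I x v"] x.\<omega>K_I_right[of "I' w u" v] J.deriv_antisym[of w u "I x v"]
      by linarith
    moreover have "\<omega>J x (I x (I' (I x v) u) - I x (I' (I x u) v) - (I' u v - I' v u)) w
        = - \<omega>K x (I' (I x v) u) w + \<omega>K x (I' (I x u) v) w - \<omega>J x (I' u v) w + \<omega>J x (I' v u) w"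
      by (simp add: blinfun.bilinear_simps x.\<omega>J_I)
    ultimately show ?thesis
      unfolding flat_J_deriv flat_K_deriv using closed by linarith
  qed
  then have "\<omega>J x (I x (I' (I x v) u) - I x (I' (I x u) v) - (I' u v - I' v u)) = 0"
    by (intro blinfun_eqI) simp
  then show ?thesis using x.nondeg by fastforce
qed

text \<open>The complex graph identity splits into the real identities
  \<open>flat_courant_form_graph\<close> for \<open>\<omega>K\<close> and \<open>\<omega>J\<close>.
  The covectors \<open>\<kappa>11\<close> to \<open>\<kappa>22\<close> are the form parts of the
  four real brackets in the complex bilinear extension.\<close>

lemma flat_involutive_symplectic:
  fixes \<kappa>11 \<kappa>12 \<kappa>21 \<kappa>22 :: "'e \<Rightarrow>\<^sub>L real"
  assumes c: "cos t \<noteq> 0"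
    and X1: "(X1 has_derivative X1') (at x)" and X2: "(X2 has_derivative X2') (at x)"
    and Y1: "(Y1 has_derivative Y1') (at x)" and Y2: "(Y2 has_derivative Y2') (at x)"
    and \<xi>1: "(\<xi>1 has_derivative \<xi>1') (at x)" and \<xi>2: "(\<xi>2 has_derivative \<xi>2') (at x)"
    and \<eta>1: "(\<eta>1 has_derivative \<eta>1') (at x)" and \<eta>2: "(\<eta>2 has_derivative \<eta>2') (at x)"
    and s: "\<And>y. y \<in> S \<Longrightarrow> ((X1 y, \<xi>1 y), (X2 y, \<xi>2 y)) \<in> plus_i_eigenspace (J_interp I \<omega>J t y)"
    and r: "\<And>y. y \<in> S \<Longrightarrow> ((Y1 y, \<eta>1 y), (Y2 y, \<eta>2 y)) \<in> plus_i_eigenspace (J_interp I \<omega>J t y)"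
    and \<kappa>11: "\<And>v. \<kappa>11 v = flat_courant_form (X1 x) X1' \<xi>1' (Y1 x) (\<eta>1 x) \<eta>1' v"
    and \<kappa>22: "\<And>v. \<kappa>22 v = flat_courant_form (X2 x) X2' \<xi>2' (Y2 x) (\<eta>2 x) \<eta>2' v"
    and \<kappa>12: "\<And>v. \<kappa>12 v = flat_courant_form (X1 x) X1' \<xi>1' (Y2 x) (\<eta>2 x) \<eta>2' v"
    and \<kappa>21: "\<And>v. \<kappa>21 v = flat_courant_form (X2 x) X2' \<xi>2' (Y1 x) (\<eta>1 x) \<eta>1' v"
  shows "((flat_lie (X1 x) X1' (Y1 x) Y1' - flat_lie (X2 x) X2' (Y2 x) Y2', \<kappa>11 - \<kappa>22),
      (flat_lie (X1 x) X1' (Y2 x) Y2' + flat_lie (X2 x) X2' (Y1 x) Y1', \<kappa>12 + \<kappa>21))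
    \<in> plus_i_eigenspace (J_interp I \<omega>J t x)"
proof -
  define a b where "a = tan t" and "b = 1 / cos t"
  note graph = holomorphic_symplectic_at.plus_i_eigenspace_J_interp[OF alg c, folded a_def b_def]
  \<comment> \<open>The graph equations hold on all of \<open>S\<close>, so they may be
    differentiated at \<open>x\<close>.\<close>
  have \<xi>': "\<xi>1' = (\<lambda>h. a *\<^sub>R (K' h (X1 x) + \<omega>K x (X1' h)) + b *\<^sub>R (J' h (X2 x) + \<omega>J x (X2' h)))"
    "\<xi>2' = (\<lambda>h. a *\<^sub>R (K' h (X2 x) + \<omega>K x (X2' h)) - b *\<^sub>R (J' h (X1 x) + \<omega>J x (X1' h)))"
    by (rule ext, rule has_derivative_unique_open[OF \<xi>1 _ J.S], rule has_derivative_add,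
        (rule has_derivative_scaleR_right J.deriv_graph K.deriv_graph X1 X2)+, use s graph in blast,
        rule ext, rule has_derivative_unique_open[OF \<xi>2 _ J.S], rule has_derivative_diff,
        (rule has_derivative_scaleR_right J.deriv_graph K.deriv_graph X1 X2)+, use s graph in blast)
  have \<eta>': "\<eta>1' = (\<lambda>h. a *\<^sub>R (K' h (Y1 x) + \<omega>K x (Y1' h)) + b *\<^sub>R (J' h (Y2 x) + \<omega>J x (Y2' h)))"
    "\<eta>2' = (\<lambda>h. a *\<^sub>R (K' h (Y2 x) + \<omega>K x (Y2' h)) - b *\<^sub>R (J' h (Y1 x) + \<omega>J x (Y1' h)))"
    by (rule ext, rule has_derivative_unique_open[OF \<eta>1 _ J.S], rule has_derivative_add,
        (rule has_derivative_scaleR_right J.deriv_graph K.deriv_graph Y1 Y2)+, use r graph in blast,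
        rule ext, rule has_derivative_unique_open[OF \<eta>2 _ J.S], rule has_derivative_diff,
        (rule has_derivative_scaleR_right J.deriv_graph K.deriv_graph Y1 Y2)+, use r graph in blast)
  have \<eta>: "\<eta>1 x = a *\<^sub>R \<omega>K x (Y1 x) + b *\<^sub>R \<omega>J x (Y2 x)"
    "\<eta>2 x = a *\<^sub>R \<omega>K x (Y2 x) - b *\<^sub>R \<omega>J x (Y1 x)"
    using r[OF J.S(2)] graph[OF J.S(2)] by blast+
  let ?K = "\<lambda>X X' Y Y'. flat_courant_form X X' (\<lambda>h. K' h X + \<omega>K x (X' h)) Y (\<omega>K x Y) (\<lambda>h. K' h Y + \<omega>K x (Y' h))"
  let ?J = "\<lambda>X X' Y Y'. flat_courant_form X X' (\<lambda>h. J' h X + \<omega>J x (X' h)) Y (\<omega>J x Y) (\<lambda>h. J' h Y + \<omega>J x (Y' h))"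
  \<comment> \<open>The coefficient of \<open>\<omega>J\<close> is imaginary and mixes the two real
    parts: its contributions to \<open>\<kappa>11\<close> and \<open>\<kappa>22\<close> form graph
    brackets only jointly, for the pairs \<open>X1, Y2\<close> and \<open>X2, Y1\<close>.\<close>
  have "\<kappa>11 v - \<kappa>22 v =
      a * (?K (X1 x) X1' (Y1 x) Y1' v - ?K (X2 x) X2' (Y2 x) Y2' v)
      + b * (?J (X1 x) X1' (Y2 x) Y2' v + ?J (X2 x) X2' (Y1 x) Y1' v)" for v
    unfolding \<kappa>11 \<kappa>22 \<xi>' \<eta>' \<eta> flat_courant_form_def
    by (simp add: blinfun.bilinear_simps algebra_simps)
  then have re: "\<kappa>11 - \<kappa>22 =
      a *\<^sub>R \<omega>K x (flat_lie (X1 x) X1' (Y1 x) Y1' - flat_lie (X2 x) X2' (Y2 x) Y2')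
      + b *\<^sub>R \<omega>J x (flat_lie (X1 x) X1' (Y2 x) Y2' + flat_lie (X2 x) X2' (Y1 x) Y1')"
    by (intro blinfun_eqI)
      (simp add: blinfun.bilinear_simps J.flat_courant_form_graph K.flat_courant_form_graph)
  have "\<kappa>12 v + \<kappa>21 v =
      a * (?K (X1 x) X1' (Y2 x) Y2' v + ?K (X2 x) X2' (Y1 x) Y1' v)
      - b * (?J (X1 x) X1' (Y1 x) Y1' v - ?J (X2 x) X2' (Y2 x) Y2' v)" for v
    unfolding \<kappa>12 \<kappa>21 \<xi>' \<eta>' \<eta> flat_courant_form_def
    by (simp add: blinfun.bilinear_simps algebra_simps)
  then have im: "\<kappa>12 + \<kappa>21 =
      a *\<^sub>R \<omega>K x (flat_lie (X1 x) X1' (Y2 x) Y2' + flat_lie (X2 x) X2' (Y1 x) Y1')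
      - b *\<^sub>R \<omega>J x (flat_lie (X1 x) X1' (Y1 x) Y1' - flat_lie (X2 x) X2' (Y2 x) Y2')"
    by (intro blinfun_eqI)
      (simp add: blinfun.bilinear_simps J.flat_courant_form_graph K.flat_courant_form_graph)
  show ?thesis
    unfolding graph[OF J.S(2)] using re im by blast
qed

text \<open>Substituting \<open>X2 = I X1\<close>, \<open>\<xi>2 = - (\<xi>1 o\<^sub>L I)\<close>
  and likewise for the second section, the terms with derivatives of the sections match by algebra;
  those with \<open>I'\<close> combine to the Nijenhuis expression, which is zero.\<close>

lemma flat_involutive_complex:
  fixes \<kappa>11 \<kappa>12 \<kappa>21 \<kappa>22 :: "'e \<Rightarrow>\<^sub>L real"
  assumes X1: "(X1 has_derivative X1') (at x)" and X2: "(X2 has_derivative X2') (at x)"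
    and Y1: "(Y1 has_derivative Y1') (at x)" and Y2: "(Y2 has_derivative Y2') (at x)"
    and \<xi>1: "(\<xi>1 has_derivative \<xi>1') (at x)" and \<xi>2: "(\<xi>2 has_derivative \<xi>2') (at x)"
    and \<eta>1: "(\<eta>1 has_derivative \<eta>1') (at x)" and \<eta>2: "(\<eta>2 has_derivative \<eta>2') (at x)"
    and s: "\<And>y. y \<in> S \<Longrightarrow> ((X1 y, \<xi>1 y), (X2 y, \<xi>2 y)) \<in> plus_i_eigenspace (J_complex I y)"
    and r: "\<And>y. y \<in> S \<Longrightarrow> ((Y1 y, \<eta>1 y), (Y2 y, \<eta>2 y)) \<in> plus_i_eigenspace (J_complex I y)"
    and \<kappa>11: "\<And>v. \<kappa>11 v = flat_courant_form (X1 x) X1' \<xi>1' (Y1 x) (\<eta>1 x) \<eta>1' v"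
    and \<kappa>22: "\<And>v. \<kappa>22 v = flat_courant_form (X2 x) X2' \<xi>2' (Y2 x) (\<eta>2 x) \<eta>2' v"
    and \<kappa>12: "\<And>v. \<kappa>12 v = flat_courant_form (X1 x) X1' \<xi>1' (Y2 x) (\<eta>2 x) \<eta>2' v"
    and \<kappa>21: "\<And>v. \<kappa>21 v = flat_courant_form (X2 x) X2' \<xi>2' (Y1 x) (\<eta>1 x) \<eta>1' v"
  shows "((flat_lie (X1 x) X1' (Y1 x) Y1' - flat_lie (X2 x) X2' (Y2 x) Y2', \<kappa>11 - \<kappa>22),
      (flat_lie (X1 x) X1' (Y2 x) Y2' + flat_lie (X2 x) X2' (Y1 x) Y1', \<kappa>12 + \<kappa>21))
    \<in> plus_i_eigenspace (J_complex I x)"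
proof -
  have eig: "((X, \<xi>), (Y, \<eta>)) \<in> plus_i_eigenspace (J_complex I y) \<longleftrightarrow> Y = I y X \<and> \<eta> = - (\<xi> o\<^sub>L I y)"
    if "y \<in> S" for X \<xi> Y \<eta> y
    by (rule plus_i_eigenspace_J_complex) (rule holomorphic_symplectic_at.I_I[OF alg[OF that]])
  have vec': "Z' h = I' h (Z1 x) + I x (Z1' h)"
    if "(Z has_derivative Z') (at x)" "(Z1 has_derivative Z1') (at x)"
      "\<And>y. y \<in> S \<Longrightarrow> Z y = I y (Z1 y)" for Z Z' Z1 Z1' h
    using has_derivative_unique_open[OF that(1) has_derivative_blinfun_apply[OF I that(2)] J.S that(3)]
    by (simp add: add.commute)
  have covec': "\<zeta>' h v = - \<zeta>1' h (I x v) - \<zeta>1 x (I' h v)"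
    if "(\<zeta> has_derivative \<zeta>') (at x)" "(\<zeta>1 has_derivative \<zeta>1') (at x)"
      "\<And>y. y \<in> S \<Longrightarrow> \<zeta> y = - (\<zeta>1 y o\<^sub>L I y)" for \<zeta> \<zeta>' \<zeta>1 \<zeta>1' h v
    using has_derivative_unique_open[OF that(1)
        has_derivative_minus[OF has_derivative_blinfun_compose[OF that(2) I]] J.S that(3), of h]
    by (simp add: blinfun.bilinear_simps)
  have X2': "X2' h = I' h (X1 x) + I x (X1' h)" for h
    using vec'[OF X2 X1] s eig by blast
  have Y2': "Y2' h = I' h (Y1 x) + I x (Y1' h)" for h
    using vec'[OF Y2 Y1] r eig by blast
  have \<xi>2': "\<xi>2' h v = - \<xi>1' h (I x v) - \<xi>1 x (I' h v)" for h v
    using covec'[OF \<xi>2 \<xi>1] s eig by blast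
  have \<eta>2': "\<eta>2' h v = - \<eta>1' h (I x v) - \<eta>1 x (I' h v)" for h v
    using covec'[OF \<eta>2 \<eta>1] r eig by blast
  have val: "X2 x = I x (X1 x)" "Y2 x = I x (Y1 x)" "\<xi>2 x = - (\<xi>1 x o\<^sub>L I x)" "\<eta>2 x = - (\<eta>1 x o\<^sub>L I x)"
    using s r eig J.S(2) by blast+
  have lin: "bounded_linear X1'" "bounded_linear Y1'" "bounded_linear \<xi>1'" "bounded_linear \<eta>1'"
    using X1 Y1 \<xi>1 \<eta>1 by (auto dest: has_derivative_bounded_linear)
  note neg = lin[THEN bounded_linear.linear, THEN linear_neg]
  have I'neg: "I' (- h) = - I' h" for h
    using has_derivative_bounded_linear[OF I] linear_neg[OF bounded_linear.linear] by blast
  let ?X = "X1 x" and ?Y = "Y1 x"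
  have vec: "flat_lie ?X X1' (Y2 x) Y2' + flat_lie (X2 x) X2' ?Y Y1'
      = I x (flat_lie ?X X1' ?Y Y1' - flat_lie (X2 x) X2' (Y2 x) Y2')"
    using nijenhuis[of ?Y ?X]
    by (simp add: flat_lie_def val X2' Y2' blinfun.bilinear_simps x.I_I algebra_simps)
  have cov: "\<kappa>12 v + \<kappa>21 v = - (\<kappa>11 (I x v) - \<kappa>22 (I x v))" for v
  proof -
    \<comment> \<open>For the form part, the Nijenhuis identity is needed with the test vector
      \<open>v\<close> as one argument, paired with each of the two 1-forms.\<close>
    have "\<eta>1 x (I x (I' (I x v) ?X)) - \<eta>1 x (I x (I' (I x ?X) v)) = \<eta>1 x (I' ?X v) - \<eta>1 x (I' v ?X)"
      using arg_cong[OF nijenhuis[of v ?X], of "blinfun_apply (\<eta>1 x)"] by (simp add: blinfun.bilinear_simps)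
    moreover have "\<xi>1 x (I x (I' (I x v) ?Y)) - \<xi>1 x (I x (I' (I x ?Y) v)) = \<xi>1 x (I' ?Y v) - \<xi>1 x (I' v ?Y)"
      using arg_cong[OF nijenhuis[of v ?Y], of "blinfun_apply (\<xi>1 x)"] by (simp add: blinfun.bilinear_simps)
    ultimately show ?thesis
      unfolding \<kappa>11 \<kappa>22 \<kappa>12 \<kappa>21 flat_courant_form_def val X2' Y2' \<xi>2' \<eta>2'
      by (simp add: blinfun.bilinear_simps x.I_I I'_I neg I'neg)
  qed
  have "\<kappa>12 + \<kappa>21 = - ((\<kappa>11 - \<kappa>22) o\<^sub>L I x)"
    by (rule blinfun_eqI) (simp add: blinfun.bilinear_simps cov)
  with vec show ?thesis
    unfolding eig[OF J.S(2)] by blast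
qed

end

section \<open>Passage to charts\<close>

locale smooth_manifold =
  fixes A :: "('m::{t2_space, second_countable_topology}, 'e::euclidean_space) chart set"
  assumes atlas: "smooth_atlas A"
begin

section \<open>Charts, Jacobians and coordinate expressions\<close>

lemma base_chart: "base_chart A p \<in> A" "p \<in> fst (base_chart A p)"
proof -
  have "p \<in> (\<Union>c\<in>A. fst c)" using atlas by (simp add: smooth_atlas_def)
  then have "\<exists>c. c \<in> A \<and> p \<in> fst c" by blast
  from someI_ex[OF this] show "base_chart A p \<in> A" "p \<in> fst (base_chart A p)"
    by (auto simp: base_chart_def)
qed

lemma chart_homeomorphism:
  assumes "c \<in> A"
  shows "open (fst c)" "open (snd c ` fst c)"
    "homeomorphism (fst c) (snd c ` fst c) (snd c) (chart_inv c)"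
  using assms atlas by (auto simp: smooth_atlas_def is_chart_def)

lemma chart_inv_chart: "c \<in> A \<Longrightarrow> p \<in> fst c \<Longrightarrow> chart_inv c (snd c p) = p"
  using homeomorphism_apply1[OF chart_homeomorphism(3)] .

lemma open_chart_image:
  assumes "c \<in> A" "open U"
  shows "open (snd c ` (fst c \<inter> U))"
proof -
  have "openin (top_of_set (snd c ` fst c)) (snd c ` (fst c \<inter> U))"
    using assms chart_homeomorphism(3)[OF assms(1)]
    by (intro homeomorphism_imp_open_map[where T = "snd c ` fst c"]) auto
  then show ?thesis
    using openin_open_trans chart_homeomorphism(2)[OF assms(1)] by blast
qed

lemma transition_has_derivative:
  assumes "c \<in> A" "d \<in> A" "p \<in> fst c" "p \<in> fst d"
  shows "(transition c d has_derivative jacobian c d p) (at (snd c p))"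
proof -
  have "smooth_on (snd c ` (fst c \<inter> fst d)) (transition c d)"
    using atlas assms by (auto simp: smooth_atlas_def)
  then have D: "(transition c d has_derivative frechet_derivative (transition c d) (at (snd c p))) (at (snd c p))"
    by (rule smooth_on_imp_has_derivative) (use assms in auto)
  then show ?thesis
    by (simp add: jacobian_def bounded_linear_Blinfun_apply has_derivative_bounded_linear)
qed

lemma jacobian_self:
  assumes "c \<in> A" "p \<in> fst c"
  shows "jacobian c c p = id_blinfun"
proof (rule blinfun_eqI)
  fix h
  have "transition c c y = y" if "y \<in> snd c ` fst c" for y
    using that assms(1) by (auto simp: transition_def chart_inv_chart)
  from has_derivative_unique_open[OF transition_has_derivative[OF assms(1,1,2,2)]
      has_derivative_ident chart_homeomorphism(2)[OF assms(1)] _ this, of h]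
  show "jacobian c c p h = id_blinfun h" using assms(2) by simp
qed

lemma jacobian_inverse:
  assumes "c \<in> A" "d \<in> A" "p \<in> fst c" "p \<in> fst d"
  shows "jacobian d c p (jacobian c d p v) = v"
proof -
  have [simp]: "transition c d (snd c q) = snd d q" if "q \<in> fst c" for q
    using that assms by (simp add: transition_def chart_inv_chart)
  have [simp]: "transition d c (snd d q) = snd c q" if "q \<in> fst d" for q
    using that assms by (simp add: transition_def chart_inv_chart)
  have "((\<lambda>x. transition d c (transition c d x)) has_derivative
      (\<lambda>h. jacobian d c p (jacobian c d p h))) (at (snd c p))"
    by (rule has_derivative_compose[OF transition_has_derivative[OF assms]])
       (use transition_has_derivative[OF assms(2,1,4,3)] assms in simp)
  moreover have "transition d c (transition c d y) = y" if "y \<in> snd c ` (fst c \<inter> fst d)" for y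
    using that by auto
  ultimately show ?thesis
    using has_derivative_unique_open[OF _ has_derivative_ident
      open_chart_image[OF assms(1) chart_homeomorphism(1)[OF assms(2)]]] assms(3,4)
    by blast
qed

text \<open>An operator-valued form of \<open>endo_rep\<close>: it has a single derivative as a map
  into the operator space, to which the product rule applies. \<open>form2_loc\<close> plays the
  same role for \<open>form2_rep\<close>.\<close>

definition endo_loc :: "('m, 'e) chart \<Rightarrow> ('m \<Rightarrow> 'e \<Rightarrow>\<^sub>L 'e) \<Rightarrow> 'e \<Rightarrow> 'e \<Rightarrow>\<^sub>L 'e" where
  "endo_loc c F x = (let p = chart_inv c x; b = base_chart A p
    in jacobian b c p o\<^sub>L F p o\<^sub>L jacobian c b p)"

definition form2_loc ::
    "('m, 'e) chart \<Rightarrow> ('m, 'e, 'b::real_normed_vector) form2 \<Rightarrow> 'e \<Rightarrow> 'e \<Rightarrow>\<^sub>L 'e \<Rightarrow>\<^sub>L 'b" where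
  "form2_loc c \<omega> x = (let p = chart_inv c x; b = base_chart A p
    in Blinfun (\<lambda>u. \<omega> p (jacobian c b p u) o\<^sub>L jacobian c b p))"

lemma endo_loc_apply: "endo_loc c F x u = endo_rep A c F x u"
  by (simp add: endo_loc_def endo_rep_def Let_def)

lemma form2_loc_apply: "form2_loc c \<omega> x u v = form2_rep A c \<omega> x u v"
proof -
  have "bounded_linear (\<lambda>u. \<omega> p (blinfun_apply j u) o\<^sub>L j)" for p and j :: "'e \<Rightarrow>\<^sub>L 'e"
    by (intro bounded_linear_compose[OF bounded_bilinear.bounded_linear_left[OF bounded_bilinear_blinfun_compose]]
        bounded_linear_compose[OF blinfun.bounded_linear_right] blinfun.bounded_linear_right)
  then show ?thesis
    by (simp add: form2_loc_def form2_rep_def Let_def bounded_linear_Blinfun_apply)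
qed

lemma smooth_on_endo_loc:
  assumes "smooth_endo A F" "c \<in> A"
  shows "smooth_on (snd c ` fst c) (endo_loc c F)"
  using assms chart_homeomorphism(2)[OF assms(2)]
  by (intro smooth_on_blinfun_componentwise) (auto simp: endo_loc_apply smooth_endo_def)

lemma smooth_on_form2_loc:
  assumes "smooth_form2 A \<omega>" "c \<in> A"
  shows "smooth_on (snd c ` fst c) (form2_loc c \<omega>)"
  using assms chart_homeomorphism(2)[OF assms(2)]
  by (intro smooth_on_blinfun_componentwise) (auto simp: form2_loc_apply smooth_form2_def)

lemma
  fixes p defines "c \<equiv> base_chart A p"
  shows endo_loc_base_chart: "endo_loc c F (snd c p) = F p"
    and form2_loc_base_chart: "form2_loc c \<omega> (snd c p) = \<omega> p"
    and vec_rep_base_chart: "vec_rep A c X (snd c p) = X p"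
    and covec_rep_base_chart: "covec_rep A c \<xi> (snd c p) = \<xi> p"
  using base_chart[of p]
  by (auto intro!: blinfun_eqI simp: c_def endo_loc_def form2_loc_apply form2_rep_def
      vec_rep_def covec_rep_def Let_def chart_inv_chart jacobian_self)

lemma gen_transfer_gen_transfer:
  assumes "c \<in> A" "d \<in> A" "p \<in> fst c" "p \<in> fst d"
  shows "gen_transfer d c p (gen_transfer c d p w) = w"
  by (cases w) (auto intro!: blinfun_eqI simp: gen_transfer_def jacobian_inverse[OF assms])

lemma gen_transfer_minus: "gen_transfer c d p (- w) = - gen_transfer c d p w"
  by (simp add: gen_transfer_def blinfun.minus_right
      bounded_bilinear.minus_left[OF bounded_bilinear_blinfun_compose])

lemma gen_transfer_base_chart:
  "gen_transfer (base_chart A (chart_inv c x)) c (chart_inv c x) (s (chart_inv c x)) =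
    (vec_rep A c (\<lambda>p. fst (s p)) x, covec_rep A c (\<lambda>p. snd (s p)) x)"
  by (simp add: gen_transfer_def vec_rep_def covec_rep_def Let_def)

text \<open>Conjugation by \<open>gen_transfer\<close> carries eigenvectors to eigenvectors. The
  point of working in an arbitrary chart around \<open>p\<close> is that the eigenvector equations
  then hold at all nearby points in the same chart and can be differentiated.\<close>

lemma plus_i_eigenspace_gen_endo_rep:
  assumes "c \<in> A" "p \<in> fst c" and p: "(s p, r p) \<in> plus_i_eigenspace (J p)"
  shows "((vec_rep A c (\<lambda>p. fst (s p)) (snd c p), covec_rep A c (\<lambda>p. snd (s p)) (snd c p)),
      (vec_rep A c (\<lambda>p. fst (r p)) (snd c p), covec_rep A c (\<lambda>p. snd (r p)) (snd c p)))
    \<in> plus_i_eigenspace (gen_endo_rep A c J (snd c p))"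
  using p assms(1,2) base_chart[of p]
  by (simp add: plus_i_eigenspace_def gen_endo_rep_def Let_def gen_transfer_gen_transfer
      gen_transfer_minus chart_inv_chart flip: gen_transfer_base_chart)

lemma smooth_form2_bounded_linear:
  fixes \<sigma> :: "('m, 'e, 'b::real_normed_vector) form2" and \<omega> :: "('m, 'e, 'c::real_normed_vector) form2"
  assumes "bounded_linear h" "smooth_form2 A \<sigma>" and \<omega>: "\<And>p u v. \<omega> p u v = h (\<sigma> p u v)"
  shows "smooth_form2 A \<omega>"
proof -
  have "form2_rep A c \<omega> x u v = h (form2_rep A c \<sigma> x u v)" for c x u v
    by (simp add: form2_rep_def Let_def \<omega>)
  then show ?thesis
    using assms chart_homeomorphism(2)
    by (auto simp: smooth_form2_def linear_0 bounded_linear.linear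
        intro!: smooth_on_bounded_linear[OF _ assms(1)])
qed

lemma ext_deriv2_form2_loc:
  fixes p defines "c \<equiv> base_chart A p"
  assumes "smooth_form2 A \<omega>"
  defines "D \<equiv> frechet_derivative (form2_loc c \<omega>) (at (snd c p))"
  shows "ext_deriv2 A \<omega> p u v w = D u v w + D v w u + D w u v"
proof -
  have D: "(form2_loc c \<omega> has_derivative D) (at (snd c p))"
    unfolding D_def using base_chart[of p]
    by (intro smooth_on_imp_has_derivative[OF smooth_on_form2_loc[OF assms(2)]]) (auto simp: c_def)
  have "((\<lambda>x. form2_rep A c \<omega> x a b) has_derivative (\<lambda>h. D h a b)) (at (snd c p))" for a b
    using has_derivative_blinfun_apply[OF has_derivative_blinfun_apply[OF D has_derivative_const[of a]]
        has_derivative_const[of b]]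
    by (simp add: form2_loc_apply)
  from frechet_derivative_at[OF this, symmetric]
  show ?thesis by (simp add: ext_deriv2_def Let_def flip: c_def)
qed

lemma closed_form2_bounded_linear:
  fixes \<sigma> :: "('m, 'e, 'b::real_normed_vector) form2" and \<omega> :: "('m, 'e, 'c::real_normed_vector) form2"
  assumes h: "bounded_linear h" and \<sigma>: "smooth_form2 A \<sigma>" "closed_form2 A \<sigma>"
    and \<omega>: "\<And>p u v. \<omega> p u v = h (\<sigma> p u v)"
  shows "closed_form2 A \<omega>"
  unfolding closed_form2_def
proof (intro allI)
  fix p u v w
  define c where "c = base_chart A p"
  have "frechet_derivative (\<lambda>x. form2_rep A c \<omega> x a b) (at (snd c p)) y
      = h (frechet_derivative (\<lambda>x. form2_rep A c \<sigma> x a b) (at (snd c p)) y)" for a b y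
  proof -
    have "smooth_on (snd c ` fst c) (\<lambda>x. form2_rep A c \<sigma> x a b)"
      using \<sigma>(1) base_chart by (auto simp: smooth_form2_def c_def)
    then have "((\<lambda>x. form2_rep A c \<sigma> x a b) has_derivative
        frechet_derivative (\<lambda>x. form2_rep A c \<sigma> x a b) (at (snd c p))) (at (snd c p))"
      by (rule smooth_on_imp_has_derivative) (use base_chart in \<open>auto simp: c_def\<close>)
    from frechet_derivative_at[OF bounded_linear.has_derivative[OF h this]]
    show ?thesis by (simp add: form2_rep_def Let_def \<omega>) (metis (mono_tags))
  qed
  then have "ext_deriv2 A \<omega> p u v w = h (ext_deriv2 A \<sigma> p u v w)"
    by (simp add: ext_deriv2_def Let_def linear_add bounded_linear.linear[OF h] flip: c_def)
  then show "ext_deriv2 A \<omega> p u v w = 0"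
    using \<sigma>(2) by (simp add: closed_form2_def linear_0 bounded_linear.linear[OF h])
qed

text \<open>In the base chart of \<open>p\<close> the coordinate values at \<open>x\<close> are the
  stored ones. Smoothness of the sections serves to make the arguments of \<open>Blinfun\<close> in
  the bracket bounded linear, so that they can be evaluated.\<close>

lemma courant_bracket_flat:
  assumes "open U" "p \<in> U" "smooth_gen_section_on A U s" "smooth_gen_section_on A U r"
  defines "c \<equiv> base_chart A p"
  defines "X \<equiv> vec_rep A c (\<lambda>q. fst (s q))" and "\<xi> \<equiv> covec_rep A c (\<lambda>q. snd (s q))"
    and "Y \<equiv> vec_rep A c (\<lambda>q. fst (r q))" and "\<eta> \<equiv> covec_rep A c (\<lambda>q. snd (r q))"
    and "x \<equiv> snd c p"
  shows "fst (courant_bracket A s r p) = flat_lie (X x) (frechet_derivative X (at x)) (Y x) (frechet_derivative Y (at x))"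
    and "snd (courant_bracket A s r p) v = flat_courant_form (X x) (frechet_derivative X (at x)) (frechet_derivative \<xi> (at x)) (Y x) (\<eta> x) (frechet_derivative \<eta> (at x)) v"
proof -
  have c: "c \<in> A" "p \<in> fst c" by (auto simp: c_def base_chart)
  have x: "x \<in> snd c ` (fst c \<inter> U)" using c assms(2) by (auto simp: x_def)
  have "bounded_linear (frechet_derivative X (at x))" "bounded_linear (frechet_derivative \<xi> (at x))"
    unfolding X_def \<xi>_def using assms(3) c
    by (auto intro!: has_derivative_bounded_linear smooth_on_imp_has_derivative[OF _ x]
        simp: smooth_gen_section_on_def)
  moreover from this(2) have "bounded_linear (\<lambda>v. frechet_derivative \<xi> (at x) (Y x) v - frechet_derivative \<xi> (at x) v (Y x))"
    by (intro bounded_linear_sub blinfun.bounded_linear_right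
        bounded_linear_compose[OF blinfun.bounded_linear_left])
  moreover have "fst (s p) = X x" "fst (r p) = Y x" "snd (r p) = \<eta> x"
    by (simp_all add: X_def Y_def \<eta>_def x_def c_def vec_rep_base_chart covec_rep_base_chart)
  ultimately show "fst (courant_bracket A s r p) = flat_lie (X x) (frechet_derivative X (at x)) (Y x) (frechet_derivative Y (at x))"
    "snd (courant_bracket A s r p) v = flat_courant_form (X x) (frechet_derivative X (at x)) (frechet_derivative \<xi> (at x)) (Y x) (\<eta> x) (frechet_derivative \<eta> (at x)) v"
    by (simp_all add: courant_bracket_def lie_bracket_def lie_derivative1_def ext_deriv1_def Let_def
        flat_lie_def flat_courant_form_def blinfun.bilinear_simps bounded_linear_Blinfun_apply
        flip: c_def x_def X_def Y_def \<xi>_def \<eta>_def)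
qed

end

section \<open>The interpolating family on a holomorphic symplectic manifold\<close>

locale holomorphic_symplectic_manifold = smooth_manifold A
  for A :: "('m::{t2_space, second_countable_topology}, 'e::euclidean_space) chart set" +
  fixes I :: "'m \<Rightarrow> 'e \<Rightarrow>\<^sub>L 'e" and \<omega>J \<omega>K :: "('m, 'e, real) form2"
  assumes smooth_I: "smooth_endo A I"
    and smooth_J: "smooth_form2 A \<omega>J" and smooth_K: "smooth_form2 A \<omega>K"
    and closed_J: "closed_form2 A \<omega>J" and closed_K: "closed_form2 A \<omega>K"
    and at: "holomorphic_symplectic_at I \<omega>J \<omega>K p"
begin

lemma at_loc:
  assumes "c \<in> A" "x \<in> snd c ` fst c"
  shows "holomorphic_symplectic_at (endo_loc c I) (form2_loc c \<omega>J) (form2_loc c \<omega>K) x"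
proof -
  define p where "p = chart_inv c x"
  define b where "b = base_chart A p"
  interpret p: holomorphic_symplectic_at I \<omega>J \<omega>K p by (rule at)
  have p: "p \<in> fst c" using assms by (auto simp: p_def chart_inv_chart)
  have b: "b \<in> A" "p \<in> fst b" by (auto simp: b_def base_chart)
  note inv [simp] = jacobian_inverse[OF assms(1) b(1) p b(2)] jacobian_inverse[OF b(1) assms(1) b(2) p]
  have I: "endo_loc c I x u = jacobian b c p (I p (jacobian c b p u))" for u
    by (simp add: endo_loc_def Let_def flip: p_def b_def)
  have w: "form2_loc c \<omega> x u v = \<omega> p (jacobian c b p u) (jacobian c b p v)"
    for \<omega> :: "('m, 'e, real) form2" and u v
    by (simp add: form2_loc_apply form2_rep_def Let_def flip: p_def b_def)
  show ?thesis
  proof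
    fix u assume "form2_loc c \<omega>J x u = 0"
    then have "form2_loc c \<omega>J x u (jacobian b c p v) = 0" for v by simp
    then have "\<omega>J p (jacobian c b p u) = 0"
      unfolding w by (intro blinfun_eqI) simp
    then have "jacobian c b p u = 0" by (rule p.nondeg)
    then show "u = 0" using inv(1)[of u] by simp
  qed (simp_all add: I w p.I_I p.\<omega>J_self p.\<omega>K_self p.\<omega>J_I p.\<omega>K_I blinfun.minus_right)
qed

text \<open>\<open>J_t\<close> is natural under linear changes of coordinates: each ingredient is
  conjugated by the Jacobians, including the inverse of \<open>\<omega>J\<close>.\<close>

lemma gen_endo_rep_J_interp:
  assumes "c \<in> A" "x \<in> snd c ` fst c"
  shows "gen_endo_rep A c (J_interp I \<omega>J t) x = J_interp (endo_loc c I) (form2_loc c \<omega>J) t x"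
proof
  fix w :: "'e gtangent"
  define p where "p = chart_inv c x"
  define b where "b = base_chart A p"
  interpret p: holomorphic_symplectic_at I \<omega>J \<omega>K p by (rule at)
  interpret x: holomorphic_symplectic_at "endo_loc c I" "form2_loc c \<omega>J" "form2_loc c \<omega>K" x
    by (rule at_loc[OF assms])
  have p: "p \<in> fst c" using assms by (auto simp: p_def chart_inv_chart)
  have b: "b \<in> A" "p \<in> fst b" by (auto simp: b_def base_chart)
  define j j' where "j = jacobian c b p" and "j' = jacobian b c p"
  have jj' [simp]: "j' (j v) = v" "j (j' v) = v" for v
    using jacobian_inverse[OF assms(1) b(1) p b(2)] jacobian_inverse[OF b(1) assms(1) b(2) p]
    by (simp_all add: j_def j'_def)
  have I: "endo_loc c I x = j' o\<^sub>L I p o\<^sub>L j"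
    by (simp add: endo_loc_def Let_def j_def j'_def flip: p_def b_def)
  have \<omega>: "form2_loc c \<omega>J x u = \<omega>J p (j u) o\<^sub>L j" for u
    by (rule blinfun_eqI) (simp add: form2_loc_apply form2_rep_def Let_def j_def flip: p_def b_def)
  obtain u \<zeta> where w: "w = (u, \<zeta>)" by fastforce
  \<comment> \<open>The transported inverse is recognized as the local one because it solves the
    equation that determines \<open>x.W \<zeta>\<close>.\<close>
  have "form2_loc c \<omega>J x (j' (p.W (\<zeta> o\<^sub>L j'))) = \<zeta>"
    unfolding \<omega> by (rule blinfun_eqI) (simp add: p.\<omega>J_W)
  then have W: "x.W \<zeta> = j' (p.W (\<zeta> o\<^sub>L j'))"
    using x.W_\<omega>J by metis
  have "gen_endo_rep A c (J_interp I \<omega>J t) x w = gen_transfer b c p (J_interp I \<omega>J t p (gen_transfer c b p w))"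
    by (simp add: gen_endo_rep_def Let_def p_def b_def)
  also have "\<dots> = J_interp (endo_loc c I) (form2_loc c \<omega>J) t x w"
    unfolding w gen_transfer_def fst_conv snd_conv j_def[symmetric] j'_def[symmetric]
      p.J_interp_eq x.J_interp_eq W I \<omega>
    by (auto simp: blinfun.bilinear_simps intro!: blinfun_eqI)
  finally show "gen_endo_rep A c (J_interp I \<omega>J t) x w = J_interp (endo_loc c I) (form2_loc c \<omega>J) t x w" .
qed

lemma smooth_gen_endo_J_interp: "smooth_gen_endo A (J_interp I \<omega>J t)"
  unfolding smooth_gen_endo_def
proof (intro conjI allI ballI)
  show "linear (J_interp I \<omega>J t p)" for p
    by (rule holomorphic_symplectic_at.linear_J_interp[OF at])
  fix c and w :: "'e gtangent"
  assume c: "c \<in> A"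
  let ?S = "snd c ` fst c"
  let ?W = "holomorphic_symplectic_at.W (form2_loc c \<omega>J)"
  note S = chart_homeomorphism(2)[OF c]
  note I = smooth_on_endo_loc[OF smooth_I c]
  note J = smooth_on_form2_loc[OF smooth_J c]
  have W: "smooth_on ?S ?W"
    by (rule smooth_on_blinfun_inverse[OF S J]) (use holomorphic_symplectic_at.W[OF at_loc[OF c]] in auto)
  obtain u \<zeta> where w: "w = (u, \<zeta>)" by fastforce
  have bl: "bounded_linear (\<lambda>F. - (sin t *\<^sub>R blinfun_apply F u))"
    "bounded_linear (\<lambda>F. - (cos t *\<^sub>R blinfun_apply F \<zeta>))"
    "bounded_linear (\<lambda>F. cos t *\<^sub>R blinfun_apply F u)"
    "bounded_linear (\<lambda>F. sin t *\<^sub>R (\<zeta> o\<^sub>L F))"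
    by (intro bounded_linear_minus bounded_linear_compose[OF bounded_linear_scaleR_right]
        blinfun.bounded_linear_left bounded_bilinear.bounded_linear_right[OF bounded_bilinear_blinfun_compose])+
  have "smooth_on ?S (\<lambda>x. (- (sin t *\<^sub>R endo_loc c I x u) + - (cos t *\<^sub>R ?W x \<zeta>),
      sin t *\<^sub>R (\<zeta> o\<^sub>L endo_loc c I x) + cos t *\<^sub>R form2_loc c \<omega>J x u))"
    by (intro smooth_on_Pair smooth_on_add S smooth_on_bounded_linear[OF S bl(1) I]
        smooth_on_bounded_linear[OF S bl(2) W] smooth_on_bounded_linear[OF S bl(3) J]
        smooth_on_bounded_linear[OF S bl(4) I])
  then show "smooth_on ?S (\<lambda>x. gen_endo_rep A c (J_interp I \<omega>J t) x w)"
    by (rule smooth_on_cong[OF S, rotated])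
       (simp add: gen_endo_rep_J_interp[OF c] w holomorphic_symplectic_at.J_interp_eq[OF at_loc[OF c]])
qed

lemma chart_at:
  assumes "open U" "p \<in> U"
  defines "c \<equiv> base_chart A p"
  defines "x \<equiv> snd c p"
  shows "holomorphic_symplectic_chart (snd c ` (fst c \<inter> U)) x (form2_loc c \<omega>J) (form2_loc c \<omega>K)
    (frechet_derivative (form2_loc c \<omega>J) (at x)) (frechet_derivative (form2_loc c \<omega>K) (at x))
    (endo_loc c I) (frechet_derivative (endo_loc c I) (at x))"
proof -
  have c: "c \<in> A" "p \<in> fst c" by (auto simp: c_def base_chart)
  then have x: "x \<in> snd c ` fst c" "x \<in> snd c ` (fst c \<inter> U)" using assms(2) by (auto simp: x_def)
  have form: "closed_form_at (snd c ` (fst c \<inter> U)) x (form2_loc c \<omega>) (frechet_derivative (form2_loc c \<omega>) (at x))"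
    if "smooth_form2 A \<omega>" "closed_form2 A \<omega>" for \<omega> :: "('m, 'e, real) form2"
  proof
    show "open (snd c ` (fst c \<inter> U))" by (rule open_chart_image[OF c(1) assms(1)])
    show "(form2_loc c \<omega> has_derivative frechet_derivative (form2_loc c \<omega>) (at x)) (at x)"
      by (rule smooth_on_imp_has_derivative[OF smooth_on_form2_loc[OF that(1) c(1)] x(1)])
    show "form2_loc c \<omega> y v v = 0" for y v
      using that(1) by (simp add: form2_loc_apply form2_rep_def Let_def smooth_form2_def)
    show "frechet_derivative (form2_loc c \<omega>) (at x) u v w + frechet_derivative (form2_loc c \<omega>) (at x) v w u
        + frechet_derivative (form2_loc c \<omega>) (at x) w u v = 0" for u v w
      using ext_deriv2_form2_loc[OF that(1), of p u v w] that(2)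
      by (simp add: closed_form2_def c_def x_def)
  qed (fact x(2))
  show ?thesis
  proof (intro holomorphic_symplectic_chart.intro holomorphic_symplectic_chart_axioms.intro form
      smooth_J smooth_K closed_J closed_K)
    show "(endo_loc c I has_derivative frechet_derivative (endo_loc c I) (at x)) (at x)"
      by (rule smooth_on_imp_has_derivative[OF smooth_on_endo_loc[OF smooth_I c(1)] x(1)])
    show "holomorphic_symplectic_at (endo_loc c I) (form2_loc c \<omega>J) (form2_loc c \<omega>K) y"
      if "y \<in> snd c ` (fst c \<inter> U)" for y
      by (rule at_loc[OF c(1)]) (use that in auto)
  qed
qed

lemma involutive_J_interp:
  assumes "t \<in> {0..pi/2}"
  shows "involutive (smooth_gen_section_on A) (courant_bracket A)
    (\<lambda>p. plus_i_eigenspace (J_interp I \<omega>J t p))"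
  unfolding involutive_def
proof (intro allI impI ballI)
  fix U and a b d e :: "'m \<Rightarrow> 'e gtangent" and p
  assume "open U \<and> smooth_gen_section_on A U a \<and> smooth_gen_section_on A U b \<and>
      smooth_gen_section_on A U d \<and> smooth_gen_section_on A U e \<and>
      (\<forall>p\<in>U. (a p, b p) \<in> plus_i_eigenspace (J_interp I \<omega>J t p)) \<and>
      (\<forall>p\<in>U. (d p, e p) \<in> plus_i_eigenspace (J_interp I \<omega>J t p))"
  then have U: "open U" and smooth: "smooth_gen_section_on A U a" "smooth_gen_section_on A U b"
      "smooth_gen_section_on A U d" "smooth_gen_section_on A U e"
    and ab: "\<And>p. p \<in> U \<Longrightarrow> (a p, b p) \<in> plus_i_eigenspace (J_interp I \<omega>J t p)"
    and de: "\<And>p. p \<in> U \<Longrightarrow> (d p, e p) \<in> plus_i_eigenspace (J_interp I \<omega>J t p)"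
    by auto
  assume p: "p \<in> U"
  define c x where "c = base_chart A p" and "x = snd c p"
  have c: "c \<in> A" "p \<in> fst c" by (auto simp: c_def base_chart)
  let ?S = "snd c ` (fst c \<inter> U)"
  have x: "x \<in> ?S" using c p by (auto simp: x_def)
  interpret holomorphic_symplectic_chart ?S x "form2_loc c \<omega>J" "form2_loc c \<omega>K"
    "frechet_derivative (form2_loc c \<omega>J) (at x)" "frechet_derivative (form2_loc c \<omega>K) (at x)"
    "endo_loc c I" "frechet_derivative (endo_loc c I) (at x)"
    unfolding c_def x_def by (rule chart_at[OF U p])
  let ?X = "\<lambda>s. vec_rep A c (\<lambda>p. fst (s p))" and ?\<xi> = "\<lambda>s. covec_rep A c (\<lambda>p. snd (s p))"
  have vec: "(?X s has_derivative frechet_derivative (?X s) (at x)) (at x)"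
    and covec: "(?\<xi> s has_derivative frechet_derivative (?\<xi> s) (at x)) (at x)"
    if "smooth_gen_section_on A U s" for s
    using that c by (auto intro!: smooth_on_imp_has_derivative[OF _ x] simp: smooth_gen_section_on_def)
  have eig: "((?X s y, ?\<xi> s y), (?X r y, ?\<xi> r y))
      \<in> plus_i_eigenspace (J_interp (endo_loc c I) (form2_loc c \<omega>J) t y)"
    if "\<And>p. p \<in> U \<Longrightarrow> (s p, r p) \<in> plus_i_eigenspace (J_interp I \<omega>J t p)" "y \<in> ?S" for s r y
    using that plus_i_eigenspace_gen_endo_rep[OF c(1), of _ s r "J_interp I \<omega>J t"]
    by (auto simp: gen_endo_rep_J_interp[OF c(1)])
  have J_base: "J_interp (endo_loc c I) (form2_loc c \<omega>J) t x = J_interp I \<omega>J t p"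
    by (simp add: fun_eq_iff J_interp_def J_complex_def J_symplectic_def
        endo_loc_base_chart form2_loc_base_chart c_def x_def)
  note bracket = courant_bracket_flat[OF U p, folded c_def, folded x_def]
  have eq: "(courant_bracket A a d p - courant_bracket A b e p, courant_bracket A a e p + courant_bracket A b d p)
    = ((fst (courant_bracket A a d p) - fst (courant_bracket A b e p),
        snd (courant_bracket A a d p) - snd (courant_bracket A b e p)),
       (fst (courant_bracket A a e p) + fst (courant_bracket A b d p),
        snd (courant_bracket A a e p) + snd (courant_bracket A b d p)))"
    by (simp add: prod_eq_iff)
  show "(courant_bracket A a d p - courant_bracket A b e p, courant_bracket A a e p + courant_bracket A b d p)
      \<in> plus_i_eigenspace (J_interp I \<omega>J t p)"
  proof (cases "cos t = 0")
    case False
    show ?thesis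
      unfolding eq J_base[symmetric] bracket(1)[OF smooth(1,3)] bracket(1)[OF smooth(2,4)]
        bracket(1)[OF smooth(1,4)] bracket(1)[OF smooth(2,3)]
      by (rule flat_involutive_symplectic[OF False vec[OF smooth(1)] vec[OF smooth(2)] vec[OF smooth(3)]
            vec[OF smooth(4)] covec[OF smooth(1)] covec[OF smooth(2)] covec[OF smooth(3)]
            covec[OF smooth(4)] eig[OF ab] eig[OF de] bracket(2)[OF smooth(1,3)]
            bracket(2)[OF smooth(2,4)] bracket(2)[OF smooth(1,4)] bracket(2)[OF smooth(2,3)]])
  next
    case True
    \<comment> \<open>The range of \<open>t\<close> matters here: on it the cosine vanishes only at
      the right end, where the sine is +1 and \<open>J_t\<close> is exactly
      \<open>J_complex\<close>.\<close>
    have t: "t = pi / 2"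
      using True assms cos_gt_zero_pi[of t] by (cases "t = pi / 2") auto
    have J: "J_interp (endo_loc c I) (form2_loc c \<omega>J) t = J_complex (endo_loc c I)"
      unfolding t by (simp add: J_interp_def fun_eq_iff)
    show ?thesis
      unfolding eq J_base[symmetric] bracket(1)[OF smooth(1,3)] bracket(1)[OF smooth(2,4)]
        bracket(1)[OF smooth(1,4)] bracket(1)[OF smooth(2,3)] J
      by (rule flat_involutive_complex[OF vec[OF smooth(1)] vec[OF smooth(2)] vec[OF smooth(3)]
            vec[OF smooth(4)] covec[OF smooth(1)] covec[OF smooth(2)] covec[OF smooth(3)]
            covec[OF smooth(4)] eig[OF ab, unfolded J] eig[OF de, unfolded J] bracket(2)[OF smooth(1,3)]
            bracket(2)[OF smooth(2,4)] bracket(2)[OF smooth(1,4)] bracket(2)[OF smooth(2,3)]])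
  qed
qed

lemma gen_complex_structure_J_interp:
  "t \<in> {0..pi/2} \<Longrightarrow> gen_complex_structure A (J_interp I \<omega>J t)"
  using smooth_gen_endo_J_interp involutive_J_interp holomorphic_symplectic_at.gen_inner_J_interp[OF at]
    holomorphic_symplectic_at.J_interp_J_interp[OF at]
  by (simp add: gen_complex_structure_def gen_almost_complex_structure_def)

lemma symplectic_form_\<omega>J: "symplectic_form A \<omega>J"
  using smooth_J closed_J holomorphic_symplectic_at.nondeg[OF at] by (auto simp: symplectic_form_def)

end

lemma holomorphic_symplectic_atI:
  fixes I :: "'m::topological_space \<Rightarrow> 'e::euclidean_space \<Rightarrow>\<^sub>L 'e"
    and \<sigma> :: "('m, 'e, complex) form2" and \<omega>J \<omega>K :: "('m, 'e, real) form2"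
  assumes I_I: "\<And>p v. I p (I p v) = - v"
    and \<sigma>: "holomorphic_symplectic A I \<sigma>"
    and \<omega>: "\<And>p u v. \<sigma> p u v = complex_of_real (\<omega>J p u v) + \<i> * complex_of_real (\<omega>K p u v)"
  shows "holomorphic_symplectic_at I \<omega>J \<omega>K p"
proof -
  have self: "\<sigma> p v v = 0" for v
    using \<sigma> by (simp add: holomorphic_symplectic_def smooth_form2_def)
  have antisym: "\<sigma> p u v = - \<sigma> p v u" for u v
    using self[of "u + v"] by (simp add: blinfun.add_left blinfun.add_right self eq_neg_iff_add_eq_0 add.commute)
  have J: "\<omega>J p u v = Re (\<sigma> p u v)" and K: "\<omega>K p u v = Im (\<sigma> p u v)" for u v
    by (simp_all add: \<omega>)
  have type: "\<sigma> p (I p u) v = \<i> * \<sigma> p u v" for u v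
  proof -
    \<comment> \<open>The pair stands for \<open>u + i I u\<close>, of type (0,1); contracting it
      with \<open>\<sigma>\<close> gives zero, which is the claim.\<close>
    have "(u, I p u) \<in> minus_i_eigenspace (I p)" by (simp add: minus_i_eigenspace_def I_I)
    then have "complex_bilinear_ext (\<sigma> p) (u, I p u) (v, 0) = 0"
      using \<sigma> by (simp add: holomorphic_symplectic_def)
    then have "\<i> * (\<sigma> p u v + \<i> * \<sigma> p (I p u) v) = 0"
      by (simp add: complex_bilinear_ext_def)
    then show ?thesis by (simp add: algebra_simps)
  qed
  show ?thesis
  proof
    fix u assume "\<omega>J p u = 0"
    then have J0: "\<omega>J p u v = 0" for v by simp
    \<comment> \<open>The real part of a (2,0)-form determines its imaginary part, so a kernel
      vector of \<open>\<omega>J\<close> is one of \<open>\<sigma>\<close>. Its (1,0)-part, up to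
      the factor 2 the vector \<open>u - i I u\<close>, then contradicts nondegeneracy on
      (1,0)-vectors unless \<open>u = 0\<close>.\<close>
    have "\<omega>J p (I p v) u = - \<omega>K p v u" for v by (simp add: J K type)
    moreover have "\<omega>J p w u = 0" for w using J0[of w] antisym[of w u] by (simp add: J)
    ultimately have "\<sigma> p v u = 0" for v by (simp add: complex_eq_iff flip: J K)
    then have \<sigma>0: "\<sigma> p u v = 0" for v using antisym[of u v] by simp
    have "(u, - I p u) \<in> plus_i_eigenspace (I p)"
      by (simp add: plus_i_eigenspace_def I_I blinfun.minus_right)
    moreover have "complex_bilinear_ext (\<sigma> p) (u, - I p u) w = 0" for w
      by (simp add: complex_bilinear_ext_def \<sigma>0 type blinfun.minus_left blinfun.minus_right)
    ultimately have "(u, - I p u) = 0" using \<sigma> by (auto simp: holomorphic_symplectic_def)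
    then show "u = 0" by (simp add: zero_prod_def)
  qed (simp_all add: I_I J K self type)
qed

theorem proposition3p31:
  fixes A :: "('m::{t2_space, second_countable_topology}, 'e::euclidean_space) chart set"
    and I :: "'m \<Rightarrow> 'e \<Rightarrow>\<^sub>L 'e"
    and \<sigma> :: "('m, 'e, complex) form2"
    and \<omega>\<^sub>J \<omega>\<^sub>K :: "('m, 'e, real) form2"
    and k :: nat
  assumes "smooth_atlas A"
    and "DIM('e) = 4 * k"
    and "complex_structure A I"
    and "holomorphic_symplectic A I \<sigma>"
    and "\<And>p u v. \<sigma> p u v = complex_of_real (\<omega>\<^sub>J p u v) + \<i> * complex_of_real (\<omega>\<^sub>K p u v)"
  shows "(\<forall>t\<in>{0..pi/2}. gen_complex_structure A (J_interp I \<omega>\<^sub>J t)) \<and>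
    symplectic_form A \<omega>\<^sub>J \<and>
    J_interp I \<omega>\<^sub>J 0 = J_symplectic \<omega>\<^sub>J \<and>
    J_interp I \<omega>\<^sub>J (pi/2) = J_complex I"
proof -
  interpret smooth_manifold A by standard (rule assms(1))
  have \<sigma>: "smooth_form2 A \<sigma>" "closed_form2 A \<sigma>"
    using assms(4) by (auto simp: holomorphic_symplectic_def)
  have I: "smooth_endo A I" "\<And>p v. I p (I p v) = - v"
    using assms(3) by (auto simp: complex_structure_def)
  have re: "\<omega>\<^sub>J p u v = Re (\<sigma> p u v)" and im: "\<omega>\<^sub>K p u v = Im (\<sigma> p u v)" for p u v
    by (simp_all add: assms(5))
  interpret holomorphic_symplectic_manifold A I "\<omega>\<^sub>J" "\<omega>\<^sub>K"
  proof (intro holomorphic_symplectic_manifold.intro holomorphic_symplectic_manifold_axioms.intro)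
    show "smooth_form2 A \<omega>\<^sub>J" "closed_form2 A \<omega>\<^sub>J"
      by (rule smooth_form2_bounded_linear[OF bounded_linear_Re \<sigma>(1) re],
          rule closed_form2_bounded_linear[OF bounded_linear_Re \<sigma> re])
    show "smooth_form2 A \<omega>\<^sub>K" "closed_form2 A \<omega>\<^sub>K"
      by (rule smooth_form2_bounded_linear[OF bounded_linear_Im \<sigma>(1) im],
          rule closed_form2_bounded_linear[OF bounded_linear_Im \<sigma> im])
    show "holomorphic_symplectic_at I \<omega>\<^sub>J \<omega>\<^sub>K p" for p
      by (rule holomorphic_symplectic_atI[OF I(2) assms(4,5)])
  qed (fact smooth_manifold_axioms I(1))+
  show ?thesis
    using gen_complex_structure_J_interp symplectic_form_\<omega>J
    by (auto simp: J_interp_def fun_eq_iff)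
qed

end
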